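(* Let $n\ge 2$ be an integer. The quadratic unitary Cayley graph $\mathcal{G}_{\mathbb{Z}_n}$ is periodic if and only if either $n=2^\alpha 3^\beta$ for some nonnegative integers $\alpha,\beta$ with $\alpha+\beta\neq 0$, or $n=2^\delta 5^\gamma$ for some integers $\delta,\gamma$ with $\gamma\ge 1$ and $0\le\delta\le 2$.
   Context: Quadratic unitary Cayley graph: let $\mathbb{Z}_n$ be the ring of integers modulo $n$, $\mathbb{Z}_n^*$ its group of units, $Q_n=\{r^2: r\in\mathbb{Z}_n^*\}$ and $V_n=Q_n\cup(-Q_n)$. The graph $\mathcal{G}_{\mathbb{Z}_n}$ has vertex set $\mathbb{Z}_n$, and $u,v$ are adjacent if and only if $u-v\in V_n$. Grover walk: for a finite simple connected graph $G$ with vertex set $V(G)$ and edge set $E(G)$, let $\mathcal{A}(G)=\{(u,v),(v,u): uv\in E(G)\}$ be its set of arcs; for an arc $a=(u,v)$ put $o(a)=u$, $t(a)=v$, $a^{-1}=(v,u)$. Define the boundary matrix $N\in\mathbb{C}^{V(G)\times\mathcal{A}(G)}$ by $N_{xa}=\frac{1}{\sqrt{\deg x}}\delta_{x,t(a)}$, the coin matrix $C=2N^*N-I$, the shift matrix $R\in\mathbb{C}^{\mathcal{A}(G)\times\mathcal{A}(G)}$ by $R_{ab}=\delta_{a,b^{-1}}$, and the time evolution matrix $U=RC$. The graph $G$ is called periodic if there is a positive integer $\tau$ with $U^\tau=I$. *)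

theory Defs
  imports
    Complex_Main
    "HOL-Number_Theory.Residues"
    "Graph_Theory.Graph_Theory"
begin

section \<open>Complex matrices indexed by finite sets\<close>

text \<open>
  A complex matrix with rows indexed by a finite set I and columns indexed by a finite set J is a
  function of two arguments of which only the values on I \<times> J are meaningful. The summation set
  of a product is therefore an explicit argument, and two matrices are equal as elements of
  \<open>\<complex>\<^sup>I\<^sup>\<times>\<^sup>J\<close> if they agree on I \<times> J.
\<close>

type_synonym ('i, 'j) cmatrix = "'i \<Rightarrow> 'j \<Rightarrow> complex"

definition cmat_eq :: "'i set \<Rightarrow> 'j set \<Rightarrow> ('i, 'j) cmatrix \<Rightarrow> ('i, 'j) cmatrix \<Rightarrow> bool" where
  "cmat_eq I J A B \<longleftrightarrow> (\<forall>i\<in>I. \<forall>j\<in>J. A i j = B i j)"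

definition cmat_id :: "('i, 'i) cmatrix" where
  "cmat_id = (\<lambda>i j. if i = j then 1 else 0)"

definition cmat_mult :: "'j set \<Rightarrow> ('i, 'j) cmatrix \<Rightarrow> ('j, 'k) cmatrix \<Rightarrow> ('i, 'k) cmatrix" where
  "cmat_mult J A B = (\<lambda>i k. \<Sum>j\<in>J. A i j * B j k)"

definition cmat_adjoint :: "('i, 'j) cmatrix \<Rightarrow> ('j, 'i) cmatrix" where
  "cmat_adjoint A = (\<lambda>j i. cnj (A i j))"

primrec cmat_pow :: "'i set \<Rightarrow> ('i, 'i) cmatrix \<Rightarrow> nat \<Rightarrow> ('i, 'i) cmatrix" where
  "cmat_pow I A 0 = cmat_id"
| "cmat_pow I A (Suc k) = cmat_mult I A (cmat_pow I A k)"

section \<open>Grover walks\<close>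

text \<open>
  A finite simple graph is a \<^locale>\<open>pair_graph\<close>: a finite vertex set \<^term>\<open>pverts G\<close> and a
  symmetric, irreflexive set \<^term>\<open>parcs G\<close> of ordered pairs of vertices. The latter is
  exactly the arc set of the graph; the origin, terminus and inverse of an arc a are
  \<^term>\<open>fst a\<close>, \<^term>\<open>snd a\<close> and \<^term>\<open>prod.swap a\<close>. The definitions below are meant for such
  graphs that are moreover connected.
\<close>

definition grover_boundary :: "'v pair_pre_digraph \<Rightarrow> ('v, 'v \<times> 'v) cmatrix" where
  "grover_boundary G =
     (\<lambda>x a. if x = snd a then 1 / complex_of_real (sqrt (real (in_degree (with_proj G) x))) else 0)"

definition grover_coin :: "'v pair_pre_digraph \<Rightarrow> ('v \<times> 'v, 'v \<times> 'v) cmatrix" where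
  "grover_coin G =
     (\<lambda>a b. 2 * cmat_mult (pverts G) (cmat_adjoint (grover_boundary G)) (grover_boundary G) a b
             - cmat_id a b)"

definition grover_shift :: "('v \<times> 'v, 'v \<times> 'v) cmatrix" where
  "grover_shift = (\<lambda>a b. if a = prod.swap b then 1 else 0)"

definition grover_evolution :: "'v pair_pre_digraph \<Rightarrow> ('v \<times> 'v, 'v \<times> 'v) cmatrix" where
  "grover_evolution G = cmat_mult (parcs G) grover_shift (grover_coin G)"

definition grover_periodic :: "'v pair_pre_digraph \<Rightarrow> bool" where
  "grover_periodic G \<longleftrightarrow>
     (\<exists>\<tau>::nat. \<tau> > 0 \<and>
        cmat_eq (parcs G) (parcs G) (cmat_pow (parcs G) (grover_evolution G) \<tau>) cmat_id)"

section \<open>Quadratic unitary Cayley graphs\<close>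

definition quadratic_units :: "int \<Rightarrow> int set" where
  "quadratic_units n =
     {r [^]\<^bsub>residue_ring n\<^esub> (2::nat) | r. r \<in> Units (residue_ring n)}"

definition quadratic_connection_set :: "int \<Rightarrow> int set" where
  "quadratic_connection_set n =
     quadratic_units n \<union> {\<ominus>\<^bsub>residue_ring n\<^esub> q | q. q \<in> quadratic_units n}"

definition quadratic_unitary_Cayley_graph :: "int \<Rightarrow> int pair_pre_digraph" where
  "quadratic_unitary_Cayley_graph n =
     \<lparr> pverts = carrier (residue_ring n),
       parcs = {(u, v). u \<in> carrier (residue_ring n) \<and> v \<in> carrier (residue_ring n) \<and>
                        u \<ominus>\<^bsub>residue_ring n\<^esub> v \<in> quadratic_connection_set n} \<rparr>"

text \<open>
  For n \<ge> 2 the graph is finite, simple and connected, so its Grover walk is defined as intended.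
  Since it is symmetric, connectedness is the same as strong connectedness.
\<close>

lemma quadratic_unitary_Cayley_graph_simple:
  assumes "n \<ge> 2"
  shows "pair_graph (quadratic_unitary_Cayley_graph n)"
    and "strongly_connected (with_proj (quadratic_unitary_Cayley_graph n))"
proof -
  let ?G = "quadratic_unitary_Cayley_graph n"
  let ?R = "residue_ring n"
  interpret residues n ?R using assms by unfold_locales auto
  have car: "carrier ?R = {0..n - 1}" by (rule res_carrier_eq)
  have V: "pverts ?G = {0..n - 1}" using car by (simp add: quadratic_unitary_Cayley_graph_def)
  have unit0: "\<zero>\<^bsub>?R\<^esub> \<notin> Units ?R"
    using assms by (auto simp: Units_def res_zero_eq res_one_eq res_mult_eq)
  have Qunits: "q \<in> Units ?R" if "q \<in> quadratic_units n" for q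
    using that by (auto simp: quadratic_units_def intro: Units_pow_closed)
  have Vcar: "q \<in> carrier ?R" if "q \<in> quadratic_connection_set n" for q
    using that Qunits by (auto simp: quadratic_connection_set_def)
  have Vneg: "\<ominus>\<^bsub>?R\<^esub> q \<in> quadratic_connection_set n" if "q \<in> quadratic_connection_set n" for q
    using that Qunits by (force simp: quadratic_connection_set_def)
  have V0: "\<zero>\<^bsub>?R\<^esub> \<notin> quadratic_connection_set n"
  proof
    assume "\<zero>\<^bsub>?R\<^esub> \<in> quadratic_connection_set n"
    then obtain q where q: "q \<in> quadratic_units n" "q = \<zero>\<^bsub>?R\<^esub> \<or> \<ominus>\<^bsub>?R\<^esub> q = \<zero>\<^bsub>?R\<^esub>"
      by (auto simp: quadratic_connection_set_def)
    have "q = \<zero>\<^bsub>?R\<^esub>" using q(2) minus_minus[OF Units_closed[OF Qunits[OF q(1)]]] minus_zero by metis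
    then show False using Qunits[OF q(1)] unit0 by simp
  qed
  have swap: "v \<ominus>\<^bsub>?R\<^esub> u = \<ominus>\<^bsub>?R\<^esub> (u \<ominus>\<^bsub>?R\<^esub> v)" if "u \<in> carrier ?R" "v \<in> carrier ?R" for u v
    using that by (simp add: a_minus_def minus_add a_comm)
  have "parcs ?G \<subseteq> carrier ?R \<times> carrier ?R"
    by (auto simp: quadratic_unitary_Cayley_graph_def)
  then have fin: "finite (parcs ?G)"
    using car finite_subset by fastforce
  have symG: "symmetric (with_proj ?G)"
    unfolding symmetric_def with_proj_simps
  proof (rule symI)
    fix u v assume "(u, v) \<in> parcs ?G"
    then show "(v, u) \<in> parcs ?G"
      using Vneg[of "u \<ominus>\<^bsub>?R\<^esub> v"] by (simp add: quadratic_unitary_Cayley_graph_def swap[of u v])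
  qed
  show pg: "pair_graph ?G"
  proof unfold_locales
    show "finite (pverts ?G)" using car by (simp add: quadratic_unitary_Cayley_graph_def)
    show "finite (parcs ?G)" by (rule fin)
    show "symmetric (with_proj ?G)" by (rule symG)
    show "fst e \<noteq> snd e" if "e \<in> parcs ?G" for e
      using that V0 by (auto simp: quadratic_unitary_Cayley_graph_def a_minus_def r_neg)
  qed (auto simp: quadratic_unitary_Cayley_graph_def)
  interpret pair_graph ?G by (rule pg)
  have V1: "1 \<in> quadratic_connection_set n"
  proof -
    have "\<one>\<^bsub>?R\<^esub> [^]\<^bsub>?R\<^esub> (2::nat) \<in> quadratic_units n"
      unfolding quadratic_units_def by blast
    then have "\<one>\<^bsub>?R\<^esub> \<in> quadratic_units n" by (simp only: nat_pow_one)
    then show ?thesis by (simp add: quadratic_connection_set_def res_one_eq)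
  qed
  have reach: "int k \<rightarrow>\<^sup>*\<^bsub>with_proj ?G\<^esub> 0" if "int k < n" for k
    using that
  proof (induction k)
    case 0
    show ?case using assms V by (simp add: reachable_refl)
  next
    case (Suc k)
    have "int (Suc k) \<ominus>\<^bsub>?R\<^esub> int k = 1"
      using Suc.prems assms
      by (simp add: a_minus_def res_neg_eq res_add_eq mod_simps)
    then have "(int (Suc k), int k) \<in> parcs ?G"
      using V1 Suc.prems car by (auto simp: quadratic_unitary_Cayley_graph_def)
    moreover have "int k \<rightarrow>\<^sup>*\<^bsub>with_proj ?G\<^esub> 0" using Suc by simp
    ultimately show ?case using adj_reachable_trans by auto
  qed
  have to0: "u \<rightarrow>\<^sup>*\<^bsub>with_proj ?G\<^esub> 0" if "u \<in> pverts ?G" for u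
    using that reach[of "nat u"] V by simp
  have "u \<rightarrow>\<^sup>*\<^bsub>with_proj ?G\<^esub> v" if "u \<in> pverts ?G" "v \<in> pverts ?G" for u v
    using to0[OF that(1)] to0[OF that(2)] symmetric_reachable[OF symG] reachable_trans by blast
  moreover have "pverts ?G \<noteq> {}" using V assms by simp
  ultimately show "strongly_connected (with_proj ?G)"
    by (simp add: strongly_connected_def)
qed

end

theory Submission
  imports
    Defs
    "HOL-Number_Theory.Residue_Primitive_Roots"
    "Jordan_Normal_Form.Char_Poly"
begin

text \<open>
  If \<open>f\<close> is an adjacency eigenfunction with eigenvalue \<open>l\<close> on a \<open>k\<close>-regular graph, then the
  walk acts on the lift \<open>f \<circ> snd\<close> by the recurrence
  \<open>x (m + 2) = (2 * l / k) * x (m + 1) - x m\<close>. A periodic solution makes \<open>2 * l / k\<close> an eigenvalue of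
  an integer circulant matrix, hence an algebraic integer; conversely, if every \<open>l / k\<close> is the cosine
  of a rational multiple of \<open>\<pi>\<close>, some power of \<open>U\<close> fixes all lifts, and then unitarity of \<open>U\<close> forces
  that power to be the identity.

  For the quadratic unitary Cayley graph the eigenvalues are \<open>\<lambda>(a) = \<Sum>s\<in>V. cos (2 * \<pi> * a * s / n)\<close>,
  and \<open>\<lambda>(a * u\<^sup>2) = \<lambda>(a)\<close> for every unit \<open>u\<close>. This invariance exhibits non-integral sums
  of the numbers \<open>2 * \<lambda> / k\<close> as soon as \<open>n\<close> is divisible by 15 (sum \<open>1 / 2\<close>), by 40 (sum of
  squares \<open>3 / 2\<close>) or by a prime \<open>p > 5\<close> (sum \<open>- 4 / (p - 1)\<close>). In the remaining cases it shows that
  \<open>\<lambda>(a)\<close> vanishes unless \<open>a / n\<close> has a denominator dividing 24 or 20, where the squares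
  of units are explicit.
\<close>

section \<open>Algebraic integers as eigenvalues of integer matrices\<close>

text \<open>An eigenvalue is a root of the characteristic polynomial, which for an integer matrix is
  monic with integer coefficients.\<close>

lemma algebraic_int_eigenvalue:
  fixes x :: complex and A :: "nat \<Rightarrow> nat \<Rightarrow> int" and v :: "nat \<Rightarrow> complex"
  assumes eq: "\<And>i. i < n \<Longrightarrow> (\<Sum>j<n. of_int (A i j) * v j) = x * v i"
    and nz: "i0 < n" "v i0 \<noteq> 0"
  shows "algebraic_int x"
proof -
  define M where "M = mat n n (\<lambda>(i, j). A i j)"
  have M: "M \<in> carrier_mat n n" by (simp add: M_def)
  have M': "map_mat complex_of_int M \<in> carrier_mat n n" using M by simp
  have "eigenvector (map_mat complex_of_int M) (vec n v) x"
    unfolding eigenvector_def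
  proof (intro conjI)
    show "vec n v \<noteq> 0\<^sub>v (dim_row (map_mat complex_of_int M))"
    proof
      assume "vec n v = 0\<^sub>v (dim_row (map_mat complex_of_int M))"
      then have "vec n v $ i0 = 0" using nz(1) by (simp add: M_def)
      then show False using nz by simp
    qed
    show "map_mat complex_of_int M *\<^sub>v vec n v = x \<cdot>\<^sub>v vec n v"
      by (rule eq_vecI) (simp_all add: M_def scalar_prod_def eq lessThan_atLeast0[symmetric])
  qed (simp add: M_def)
  then have "eigenvalue (map_mat complex_of_int M) x"
    unfolding eigenvalue_def by blast
  then have "poly (char_poly (map_mat complex_of_int M)) x = 0"
    using eigenvalue_root_char_poly[OF M'] by simp
  then have root: "poly (map_poly complex_of_int (char_poly M)) x = 0"
    by (simp add: of_int_hom.char_poly_hom[OF M])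
  show ?thesis
    unfolding algebraic_int_altdef_ipoly
    using root degree_monic_char_poly[OF M] by blast
qed

lemma algebraic_int_eigenvalue_finite:
  fixes x :: complex and A :: "'i \<Rightarrow> 'i \<Rightarrow> int" and v :: "'i \<Rightarrow> complex"
  assumes fin: "finite I"
    and eq: "\<And>i. i \<in> I \<Longrightarrow> (\<Sum>j\<in>I. of_int (A i j) * v j) = x * v i"
    and nz: "i0 \<in> I" "v i0 \<noteq> 0"
  shows "algebraic_int x"
proof -
  obtain h where h: "bij_betw h {..<card I} I"
    using ex_bij_betw_nat_finite[OF fin] by (auto simp: lessThan_atLeast0)
  obtain m0 where m0: "m0 < card I" "h m0 = i0"
    using nz(1) bij_betw_imp_surj_on[OF h] by (metis imageE lessThan_iff)
  show ?thesis
  proof (rule algebraic_int_eigenvalue)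
    fix i assume i: "i < card I"
    have "(\<Sum>j<card I. of_int (A (h i) (h j)) * v (h j)) = (\<Sum>j\<in>I. of_int (A (h i) j) * v j)"
      by (rule sum.reindex_bij_betw[OF h])
    also have "\<dots> = x * v (h i)" using h i by (intro eq) (auto simp: bij_betw_def)
    finally show "(\<Sum>j<card I. of_int (A (h i) (h j)) * v (h j)) = x * v (h i)" .
  qed (use m0 nz in auto)
qed

text \<open>\<open>A\<close> is the companion matrix of a monic integer polynomial with root
  \<open>x\<close>, and the powers of \<open>x\<close> below the degree form an eigenvector.
  Algebraic integers are thus traded for integer matrices, which can be combined.\<close>

lemma algebraic_int_companion:
  fixes x :: complex
  assumes "algebraic_int x"
  obtains n :: nat and A :: "nat \<Rightarrow> nat \<Rightarrow> int" where "n > 0"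
    "\<And>i. i < n \<Longrightarrow> (\<Sum>j<n. of_int (A i j) * x ^ j) = x * x ^ i"
proof -
  obtain p :: "int poly" where p: "poly (map_poly of_int p) x = 0" "lead_coeff p = 1"
    using assms by (auto simp: algebraic_int_altdef_ipoly)
  define n where "n = degree p"
  \<comment> \<open>A monic polynomial of degree 0 is the constant 1 and has no root.\<close>
  have n: "n > 0"
  proof (rule ccontr)
    assume "\<not> n > 0"
    then have "p = 1" using p(2) by (metis n_def degree_eq_zeroE lead_coeff_pCons(2) gr0I one_pCons)
    then show False using p(1) by simp
  qed
  have "0 = (\<Sum>j\<le>n. of_int (coeff p j) * x ^ j)"
    using p(1) by (simp add: poly_altdef n_def)
  also have "\<dots> = (\<Sum>j<n. of_int (coeff p j) * x ^ j) + x ^ n"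
    using p(2) by (simp add: lessThan_Suc_atMost[symmetric] n_def)
  finally have top: "x ^ n = (\<Sum>j<n. of_int (- coeff p j) * x ^ j)"
    by (simp add: sum_negf eq_neg_iff_add_eq_0 add.commute)
  define A where "A i j = (if Suc i < n then (if j = Suc i then 1 else 0) else - coeff p j)" for i j
  show ?thesis
  proof (rule that[OF n, of A])
    fix i assume i: "i < n"
    show "(\<Sum>j<n. of_int (A i j) * x ^ j) = x * x ^ i"
    proof (cases "Suc i < n")
      case True
      have "(\<Sum>j<n. of_int (A i j) * x ^ j) = (\<Sum>j<n. if j = Suc i then x ^ j else 0)"
        by (rule sum.cong) (simp_all add: A_def True)
      then show ?thesis using True by simp
    next
      case False
      then have "n = Suc i" using i by simp
      then show ?thesis using top False by (simp add: A_def)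
    qed
  qed
qed

text \<open>For companion matrices \<open>A\<close> of \<open>x\<close> and \<open>B\<close> of
  \<open>y\<close>, the products \<open>x ^ i * y ^ j\<close> form an eigenvector of the Kronecker
  sum of \<open>A\<close> and \<open>B\<close> with eigenvalue \<open>x + y\<close>, and of their
  Kronecker product with eigenvalue \<open>x * y\<close>. Its entry at \<open>(0, 0)\<close> is
  1.\<close>

lemma algebraic_int_add_mult:
  fixes x y :: complex
  assumes "algebraic_int x" "algebraic_int y"
  shows "algebraic_int (x + y)" and "algebraic_int (x * y)"
proof -
  obtain m A where m: "m > 0" and A: "\<And>i. i < m \<Longrightarrow> (\<Sum>j<m. of_int (A i j) * x ^ j) = x * x ^ i"
    using algebraic_int_companion[OF assms(1)] by metis
  obtain n B where n: "n > 0" and B: "\<And>i. i < n \<Longrightarrow> (\<Sum>j<n. of_int (B i j) * y ^ j) = y * y ^ i"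
    using algebraic_int_companion[OF assms(2)] by metis
  let ?I = "{..<m} \<times> {..<n}"
  let ?v = "\<lambda>(i, j). x ^ i * y ^ j"
  have nz: "(0, 0) \<in> ?I" "?v (0, 0) \<noteq> 0" using m n by auto
  show "algebraic_int (x + y)"
  proof (rule algebraic_int_eigenvalue_finite[where I = ?I and v = ?v, OF _ _ nz])
    fix k assume "k \<in> ?I"
    then obtain i j where k: "k = (i, j)" "i < m" "j < n" by auto
    let ?C = "\<lambda>(i, j) (i', j'). (if j = j' then A i i' else 0) + (if i = i' then B j j' else 0)"
    have "(\<Sum>l\<in>?I. of_int (?C k l) * ?v l) =
      (\<Sum>i'<m. \<Sum>j'<n. (if j = j' then of_int (A i i') * x ^ i' * y ^ j' else 0) +
        (if i = i' then of_int (B j j') * x ^ i' * y ^ j' else 0))"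
      unfolding sum.cartesian_product k by (intro sum.cong) (auto simp: algebra_simps)
    also have "\<dots> = (\<Sum>i'<m. of_int (A i i') * x ^ i' * y ^ j) + (\<Sum>j'<n. of_int (B j j') * x ^ i * y ^ j')"
      unfolding sum.distrib
      by (rule arg_cong2[where f = "(+)"], simp add: k, subst sum.swap, simp add: k)
    also have "\<dots> = (\<Sum>i'<m. of_int (A i i') * x ^ i') * y ^ j + x ^ i * (\<Sum>j'<n. of_int (B j j') * y ^ j')"
      unfolding sum_distrib_left sum_distrib_right by (simp add: mult_ac)
    also have "\<dots> = (x + y) * ?v k"
      using A[OF k(2)] B[OF k(3)] by (simp add: k algebra_simps)
    finally show "(\<Sum>l\<in>?I. of_int (?C k l) * ?v l) = (x + y) * ?v k" .
  qed simp
  show "algebraic_int (x * y)"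
  proof (rule algebraic_int_eigenvalue_finite[where I = ?I and v = ?v, OF _ _ nz])
    fix k assume "k \<in> ?I"
    then obtain i j where k: "k = (i, j)" "i < m" "j < n" by auto
    let ?C = "\<lambda>(i, j) (i', j'). A i i' * B j j'"
    have "(\<Sum>l\<in>?I. of_int (?C k l) * ?v l) =
      (\<Sum>i'<m. \<Sum>j'<n. (of_int (A i i') * x ^ i') * (of_int (B j j') * y ^ j'))"
      unfolding sum.cartesian_product k by (intro sum.cong) (auto simp: algebra_simps)
    also have "\<dots> = (\<Sum>i'<m. of_int (A i i') * x ^ i') * (\<Sum>j'<n. of_int (B j j') * y ^ j')"
      by (simp add: sum_product)
    also have "\<dots> = (x * y) * ?v k"
      using A[OF k(2)] B[OF k(3)] by (simp add: k algebra_simps)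
    finally show "(\<Sum>l\<in>?I. of_int (?C k l) * ?v l) = (x * y) * ?v k" .
  qed simp
qed

section \<open>Grover walks on regular graphs\<close>

lemma complex_sqrt_inverse_square:
  "k > 0 \<Longrightarrow> 1 / complex_of_real (sqrt (real k)) * (1 / complex_of_real (sqrt (real k))) = 1 / of_nat k"
  by (simp flip: of_real_mult)

text \<open>If \<open>sin \<theta>\<close> is nonzero, every solution is a combination of the
  sequences sin (m \<theta>) and sin ((m - 1) \<theta>), which take the same values at \<tau> and 0.
  Otherwise the characteristic root \<sigma> = cos \<theta> is double and equal to 1 or -1, so the
  solution is \<sigma>^m times a linear function of m; boundedness makes that function constant, and
  \<sigma>^\<tau> = 1 for even \<tau>.\<close>

lemma bounded_cos_recurrence_periodic:
  fixes s :: "nat \<Rightarrow> complex" and t :: int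
  assumes rec: "\<And>m. s (Suc (Suc m)) = 2 * of_real (cos \<theta>) * s (Suc m) - s m"
    and bounded: "\<And>m. norm (s m) \<le> B"
    and \<tau>: "even \<tau>" "\<tau> * \<theta> = 2 * pi * t"
  shows "s \<tau> = s 0"
proof (cases "sin \<theta> = 0")
  case False
  \<comment> \<open>The solution formula is kept multiplied by \<open>sin \<theta>\<close> to avoid
    division, and two consecutive terms are carried along because the recurrence has order
    two.\<close>
  have "of_real (sin \<theta>) * s m = of_real (sin (m * \<theta>)) * s 1 - of_real (sin (m * \<theta> - \<theta>)) * s 0 \<and>
    of_real (sin \<theta>) * s (Suc m) = of_real (sin (Suc m * \<theta>)) * s 1 - of_real (sin (Suc m * \<theta> - \<theta>)) * s 0" for m
  proof (induction m)
    case 0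
    show ?case by simp
  next
    case (Suc m)
    have "sin (x + \<theta>) = 2 * cos \<theta> * sin x - sin (x - \<theta>)" for x
      by (simp add: sin_add sin_diff)
    from this[of "Suc m * \<theta>"] this[of "Suc m * \<theta> - \<theta>"]
    have c: "sin (Suc (Suc m) * \<theta>) = 2 * cos \<theta> * sin (Suc m * \<theta>) - sin (m * \<theta>)"
      "sin (Suc (Suc m) * \<theta> - \<theta>) = 2 * cos \<theta> * sin (Suc m * \<theta> - \<theta>) - sin (m * \<theta> - \<theta>)"
      by (simp_all add: algebra_simps)
    have "of_real (sin \<theta>) * s (Suc (Suc m)) =
        2 * of_real (cos \<theta>) * (of_real (sin \<theta>) * s (Suc m)) - of_real (sin \<theta>) * s m"
      unfolding rec by (simp add: algebra_simps)
    then show ?case using Suc by (simp only: c) (simp add: algebra_simps)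
  qed
  from this[of \<tau>] have "of_real (sin \<theta>) * s \<tau> = of_real (sin \<theta>) * s 0"
    using \<tau> by (simp add: sin_diff)
  then show ?thesis using False by simp
next
  case True
  define \<sigma> where "\<sigma> = complex_of_real (cos \<theta>)"
  have \<sigma>: "\<sigma> * \<sigma> = 1"
    using True sin_cos_squared_add[of \<theta>] by (simp add: \<sigma>_def power2_eq_square flip: of_real_mult)
  define d where "d = \<sigma> * s 1 - s 0"
  have "s m = \<sigma> ^ m * (s 0 + of_nat m * d) \<and> s (Suc m) = \<sigma> ^ Suc m * (s 0 + of_nat (Suc m) * d)" for m
  proof (induction m)
    case 0
    show ?case using \<sigma> by (simp add: d_def mult.assoc[symmetric])
  next
    case (Suc m)
    have "s (Suc (Suc m)) = 2 * \<sigma> * s (Suc m) - s m" using rec by (simp add: \<sigma>_def)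
    also have "\<dots> = (\<sigma> * \<sigma>) * \<sigma> ^ m * (2 * (s 0 + of_nat (Suc m) * d)) - \<sigma> ^ m * (s 0 + of_nat m * d)"
      using Suc by simp
    also have "\<dots> = (\<sigma> * \<sigma>) * \<sigma> ^ m * (s 0 + of_nat (Suc (Suc m)) * d)"
      unfolding \<sigma> by (simp add: algebra_simps)
    finally show ?case using Suc by (simp add: mult.assoc)
  qed
  then have s: "s m = \<sigma> ^ m * (s 0 + of_nat m * d)" for m by blast
  have "norm \<sigma> = 1" using \<sigma> by (metis norm_mult norm_one abs_norm_cancel abs_square_eq_1 power2_eq_square)
  then have le: "norm (s 0 + of_nat m * d) \<le> B" for m
    using bounded[of m] \<open>norm \<sigma> = 1\<close> by (subst (asm) s) (simp add: norm_mult norm_power)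
  have "d = 0"
  proof (rule ccontr)
    assume "d \<noteq> 0"
    then obtain m where m: "B + norm (s 0) < of_nat m * norm d"
      using ex_less_of_nat_mult[of "norm d"] by auto
    have "of_nat m * norm d = norm ((s 0 + of_nat m * d) - s 0)" by (simp add: norm_mult)
    also have "\<dots> \<le> B + norm (s 0)" using le[of m] norm_triangle_ineq4 order_trans add_right_mono by blast
    finally show False using m by simp
  qed
  moreover have "\<sigma> ^ \<tau> = 1" using \<tau>(1) \<sigma> by (auto elim!: evenE simp: power_mult power2_eq_square)
  ultimately show ?thesis by (subst s) simp
qed

section \<open>The time evolution as an operator on functions on the arcs\<close>

locale regular_pair_graph = pair_graph G for G :: "'v pair_pre_digraph" +
  fixes k :: nat
  assumes degree_pos: "k > 0"
    and regular: "x \<in> pverts G \<Longrightarrow> in_degree (with_proj G) x = k"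
begin

text \<open>The action of \<open>U\<close> on a function on the arcs. The shift replaces
  \<open>a\<close> by its reverse, whose head is \<open>fst a\<close>; the coin then takes twice the
  mean over all arcs with that head and subtracts the value at the reversed arc.\<close>

definition step :: "('v \<times> 'v \<Rightarrow> complex) \<Rightarrow> 'v \<times> 'v \<Rightarrow> complex" where
  "step g a = 2 / of_nat k * (\<Sum>b\<in>{b \<in> parcs G. snd b = fst a}. g b) - g (prod.swap a)"

lemma finite_parcs [simp]: "finite (parcs G)" and finite_pverts [simp]: "finite (pverts G)"
  using finite_arcs finite_verts by simp_all

lemma parcs_ends: "a \<in> parcs G \<Longrightarrow> fst a \<in> pverts G \<and> snd a \<in> pverts G"
  using tail_in_verts head_in_verts by auto

lemma swap_parcs: "a \<in> parcs G \<Longrightarrow> prod.swap a \<in> parcs G"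
  using arcs_symmetric by (cases a) auto

lemma card_in: "x \<in> pverts G \<Longrightarrow> card {b \<in> parcs G. snd b = x} = k"
  using regular by (simp add: in_degree_def in_arcs_def)

lemma bij_swap: "bij_betw prod.swap (parcs G) (parcs G)"
  by (rule bij_betw_byWitness[where f' = prod.swap]) (auto dest: swap_parcs)

text \<open>The shift selects the row of the coin matrix at the reversed arc. By regularity, the
  product of the adjoint boundary matrix with the boundary matrix has entry 1/k at two arcs with a
  common head and 0 elsewhere.\<close>

lemma grover_evolution_apply:
  assumes a: "a \<in> parcs G"
  shows "(\<Sum>b\<in>parcs G. grover_evolution G a b * g b) = step g a"
proof -
  let ?N = "grover_boundary G"
  have coin: "grover_coin G (prod.swap a) b = (if snd b = fst a then 2 / of_nat k else 0) - (if b = prod.swap a then 1 else 0)"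
    if b: "b \<in> parcs G" for b
  proof -
    have "(\<Sum>x\<in>pverts G. cnj (?N x (prod.swap a)) * ?N x b) =
        (\<Sum>x\<in>pverts G. if x = fst a then (if snd b = fst a then 1 / of_nat k else 0) else 0)"
      using regular complex_sqrt_inverse_square[OF degree_pos]
      by (intro sum.cong) (auto simp: grover_boundary_def)
    then show ?thesis
      using parcs_ends[OF a]
      by (auto simp: grover_coin_def cmat_mult_def cmat_adjoint_def cmat_id_def)
  qed
  have ev: "grover_evolution G a b = grover_coin G (prod.swap a) b" for b
  proof -
    have "grover_evolution G a b = (\<Sum>c\<in>parcs G. if c = prod.swap a then grover_coin G c b else 0)"
      unfolding grover_evolution_def cmat_mult_def grover_shift_def
      by (intro sum.cong) auto
    then show ?thesis using swap_parcs[OF a] by simp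
  qed
  have "(\<Sum>b\<in>parcs G. grover_evolution G a b * g b) =
      (\<Sum>b\<in>parcs G. (if snd b = fst a then 2 / of_nat k * g b else 0) - (if b = prod.swap a then g b else 0))"
    unfolding ev by (intro sum.cong) (auto simp: coin left_diff_distrib)
  also have "\<dots> = (\<Sum>b\<in>{b \<in> parcs G. snd b = fst a}. 2 / of_nat k * g b) - g (prod.swap a)"
    using swap_parcs[OF a] by (simp add: sum_subtractf sum.inter_filter del: times_divide_eq_left)
  also have "\<dots> = step g a"
    by (simp add: step_def sum_distrib_left)
  finally show ?thesis .
qed

lemma step_cong:
  assumes "\<And>b. b \<in> parcs G \<Longrightarrow> g b = h b" and "a \<in> parcs G"
  shows "step g a = step h a"
  unfolding step_def using assms swap_parcs[OF assms(2)] by (auto intro!: arg_cong2[where f = "(-)"] sum.cong)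

lemma step_lin: "step (\<lambda>a. c * g a + d * h a) a = c * step g a + d * step h a"
  by (simp add: step_def sum.distrib sum_distrib_left[symmetric] algebra_simps)

lemma cmat_pow_apply:
  assumes "a \<in> parcs G"
  shows "(\<Sum>b\<in>parcs G. cmat_pow (parcs G) (grover_evolution G) m a b * g b) = (step ^^ m) g a"
  using assms
proof (induction m arbitrary: a)
  case 0
  have "(\<Sum>b\<in>parcs G. cmat_id a b * g b) = (\<Sum>b\<in>parcs G. if b = a then g b else 0)"
    by (intro sum.cong) (auto simp: cmat_id_def)
  then show ?case using 0 by simp
next
  case (Suc m)
  let ?U = "grover_evolution G" and ?P = "cmat_pow (parcs G) (grover_evolution G) m"
  have "(\<Sum>b\<in>parcs G. (\<Sum>c\<in>parcs G. ?U a c * ?P c b) * g b) =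
     (\<Sum>c\<in>parcs G. ?U a c * (\<Sum>b\<in>parcs G. ?P c b * g b))"
    by (simp add: sum_distrib_left sum_distrib_right mult.assoc, subst sum.swap, rule refl)
  also have "\<dots> = (\<Sum>c\<in>parcs G. ?U a c * (step ^^ m) g c)"
    using Suc.IH by simp
  also have "\<dots> = step ((step ^^ m) g) a"
    by (rule grover_evolution_apply[OF Suc.prems])
  finally show ?case by (simp add: cmat_mult_def)
qed

text \<open>A matrix is the identity exactly when it fixes all vectors; for the converse direction
  it is applied to the indicator functions of single arcs, which are the columns of
  \<open>cmat_id\<close>.\<close>

lemma grover_periodic_iff:
  "grover_periodic G \<longleftrightarrow> (\<exists>\<tau>>0. \<forall>g. \<forall>a\<in>parcs G. (step ^^ \<tau>) g a = g a)"
proof -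
  have "cmat_eq (parcs G) (parcs G) (cmat_pow (parcs G) (grover_evolution G) \<tau>) cmat_id \<longleftrightarrow>
      (\<forall>g. \<forall>a\<in>parcs G. (step ^^ \<tau>) g a = g a)" (is "?L \<longleftrightarrow> ?R") for \<tau>
  proof
    assume L: ?L
    show ?R
    proof (intro allI ballI)
      fix g a assume a: "a \<in> parcs G"
      have "(step ^^ \<tau>) g a = (\<Sum>b\<in>parcs G. cmat_id a b * g b)"
        using L a by (simp add: cmat_pow_apply[OF a, symmetric] cmat_eq_def)
      also have "\<dots> = (\<Sum>b\<in>parcs G. if b = a then g b else 0)"
        by (intro sum.cong) (auto simp: cmat_id_def)
      finally show "(step ^^ \<tau>) g a = g a" using a by simp
    qed
  next
    assume R: ?R
    show ?L
      unfolding cmat_eq_def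
    proof (intro ballI)
      fix a c assume a: "a \<in> parcs G" and c: "c \<in> parcs G"
      let ?P = "cmat_pow (parcs G) (grover_evolution G) \<tau>"
      have "?P a c = (\<Sum>b\<in>parcs G. if b = c then ?P a b else 0)" using c by simp
      also have "\<dots> = (\<Sum>b\<in>parcs G. ?P a b * cmat_id b c)"
        by (intro sum.cong) (auto simp: cmat_id_def)
      also have "\<dots> = cmat_id a c"
        using R a by (simp add: cmat_pow_apply[OF a])
      finally show "?P a c = cmat_id a c" .
    qed
  qed
  then show ?thesis by (simp add: grover_periodic_def)
qed

section \<open>Lifts of adjacency eigenfunctions\<close>

definition eigenfunction :: "('v \<Rightarrow> complex) \<Rightarrow> real \<Rightarrow> bool" where
  "eigenfunction f l \<longleftrightarrow> (\<forall>v\<in>pverts G. (\<Sum>b\<in>{b \<in> parcs G. snd b = v}. f (fst b)) = of_real l * f v)"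

text \<open>All \<open>k\<close> arcs entering \<open>fst a\<close> carry the value
  \<open>f (fst a)\<close>, so the first term of \<open>step\<close> is twice this value, and the
  reversed arc removes one copy.\<close>

lemma step_head:
  assumes "a \<in> parcs G"
  shows "step (\<lambda>a. f (snd a)) a = f (fst a)"
proof -
  have "(\<Sum>b\<in>{b \<in> parcs G. snd b = fst a}. f (snd b)) = (\<Sum>b\<in>{b \<in> parcs G. snd b = fst a}. f (fst a))"
    by (intro sum.cong) auto
  also have "\<dots> = of_nat k * f (fst a)"
    using parcs_ends[OF assms] by (simp only: sum_constant card_in)
  finally show ?thesis using degree_pos card_in[of "fst a"] parcs_ends[OF assms] by (simp add: step_def)
qed

text \<open>The first two iterates are the head lift and the tail lift of \<open>f\<close>. In the
  next one the sum over arcs is a sum over neighbours, which the eigenvalue equation evaluates;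
  linearity of \<open>step\<close> propagates the relation.\<close>

lemma step_pow_eigenfunction:
  assumes f: "eigenfunction f l" and a: "a \<in> parcs G"
  shows "(step ^^ Suc (Suc m)) (\<lambda>a. f (snd a)) a =
    of_real (2 * l / k) * (step ^^ Suc m) (\<lambda>a. f (snd a)) a - (step ^^ m) (\<lambda>a. f (snd a)) a"
  using a
proof (induction m arbitrary: a)
  case 0
  have "step (step (\<lambda>a. f (snd a))) a = step (\<lambda>a. f (fst a)) a"
    by (rule step_cong[OF step_head 0])
  also have "\<dots> = of_real (2 * l / k) * f (fst a) - f (snd a)"
    using f parcs_ends[OF 0] by (simp add: step_def eigenfunction_def)
  finally show ?case using step_head[OF 0] by simp
next
  case (Suc m)
  let ?x = "\<lambda>m. (step ^^ m) (\<lambda>a. f (snd a))"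
  have "step (?x (Suc (Suc m))) a = step (\<lambda>a. of_real (2 * l / k) * ?x (Suc m) a + (-1) * ?x m a) a"
    using Suc.IH by (intro step_cong[OF _ Suc.prems]) simp
  also have "\<dots> = of_real (2 * l / k) * step (?x (Suc m)) a + (-1) * step (?x m) a"
    by (rule step_lin)
  finally show ?case by simp
qed

text \<open>The values of the iterates at one arc with head \<open>v\<close> form a \<tau>-periodic
  sequence \<open>x\<close> in which the sum of the two neighbours of a term is
  \<open>2 * l / k\<close> times that term. One period is therefore an eigenvector of an integer
  matrix, nonzero because \<open>x 0 = f v\<close>.\<close>

lemma algebraic_int_of_periodic:
  assumes per: "grover_periodic G" and f: "eigenfunction f l" and v: "v \<in> pverts G" "f v \<noteq> 0"
  shows "algebraic_int (complex_of_real (2 * l / k))"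
proof -
  obtain \<tau> where \<tau>: "\<tau> > 0" and P: "\<And>g a. a \<in> parcs G \<Longrightarrow> (step ^^ \<tau>) g a = g a"
    using per by (auto simp: grover_periodic_iff)
  have "{b \<in> parcs G. snd b = v} \<noteq> {}"
    using card_in[OF v(1)] degree_pos by (metis card.empty less_irrefl)
  then obtain a where a: "a \<in> parcs G" "snd a = v" by blast
  define x where "x m = (step ^^ m) (\<lambda>a. f (snd a)) a" for m
  have x_add: "x (\<tau> + m) = x m" for m
    using P[OF a(1)] by (simp add: x_def funpow_add)
  have x_mod: "x (m mod \<tau>) = x m" for m
  proof (induction m rule: less_induct)
    case (less m)
    show ?case
    proof (cases "m < \<tau>")
      case False
      then have "x ((m - \<tau>) mod \<tau>) = x (m - \<tau>)" using less \<tau> by simp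
      then show ?thesis using False x_add[of "m - \<tau>"] by (simp add: le_mod_geq)
    qed simp
  qed
  \<comment> \<open>Adjacency matrix of the cycle of length \<tau>, with
    \<open>(i + \<tau> - 1) mod \<tau>\<close> as predecessor of \<open>i\<close>. The indicators
    are added, so that an entry is 2 when successor and predecessor coincide, as happens for \<tau>
    at most 2.\<close>
  let ?A = "\<lambda>i j. (if j = Suc i mod \<tau> then 1 else 0) + (if j = (i + \<tau> - 1) mod \<tau> then 1 else 0)"
  show ?thesis
  proof (rule algebraic_int_eigenvalue[where v = x and n = \<tau> and A = ?A])
    fix i assume i: "i < \<tau>"
    have "(\<Sum>j<\<tau>. of_int (?A i j) * x j) =
        (\<Sum>j<\<tau>. (if j = Suc i mod \<tau> then x j else 0) + (if j = (i + \<tau> - 1) mod \<tau> then x j else 0))"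
      by (intro sum.cong) auto
    also have "\<dots> = x (Suc i mod \<tau>) + x ((i + \<tau> - 1) mod \<tau>)"
      using \<tau> by (simp add: sum.distrib)
    also have "\<dots> = x (\<tau> + Suc i) + x (i + \<tau> - 1)"
      unfolding x_mod x_add ..
    also have "\<dots> = x (Suc (Suc (i + \<tau> - 1))) + x (i + \<tau> - 1)"
      using \<tau> by (simp add: add.commute)
    also have "\<dots> = of_real (2 * l / k) * x (Suc (i + \<tau> - 1))"
      using step_pow_eigenfunction[OF f a(1), of "i + \<tau> - 1"] by (simp add: x_def)
    also have "x (Suc (i + \<tau> - 1)) = x i"
      using x_add[of i] \<tau> by (simp add: add.commute)
    finally show "(\<Sum>j<\<tau>. of_int (?A i j) * x j) = of_real (2 * l / k) * x i" .
  next
    show "x 0 \<noteq> 0" using a v by (simp add: x_def)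
  qed (rule \<tau>)
qed

section \<open>Unitarity of the walk and a criterion for periodicity\<close>

lemma sum_parcs_by_head:
  "(\<Sum>a\<in>parcs G. p (snd a) * q a) = (\<Sum>v\<in>pverts G. p v * (\<Sum>a\<in>{a \<in> parcs G. snd a = v}. q a))"
  for p :: "'v \<Rightarrow> complex"
proof -
  have "(\<Sum>a\<in>parcs G. p (snd a) * q a) = (\<Sum>v\<in>pverts G. \<Sum>a\<in>{a \<in> parcs G. snd a = v}. p (snd a) * q a)"
    by (rule sum.group[symmetric]) (auto dest: parcs_ends)
  also have "\<dots> = (\<Sum>v\<in>pverts G. p v * (\<Sum>a\<in>{a \<in> parcs G. snd a = v}. q a))"
    unfolding sum_distrib_left by (intro sum.cong) auto
  finally show ?thesis .
qed

text \<open>After reversing the arcs, \<open>step g\<close> becomes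
  \<open>c * D g (snd a) - g a\<close>. Grouping by heads, the square term carries the factor k c^2
  = 2 c, since each vertex has \<open>k\<close> incoming arcs, and cancels the two mixed
  terms.\<close>

lemma step_isometry: "(\<Sum>a\<in>parcs G. step g a * cnj (step h a)) = (\<Sum>a\<in>parcs G. g a * cnj (h a))"
proof -
  define D :: "('v \<times> 'v \<Rightarrow> complex) \<Rightarrow> 'v \<Rightarrow> complex"
    where "D q v = (\<Sum>a\<in>{a \<in> parcs G. snd a = v}. q a)" for q v
  define c :: complex where "c = 2 / of_nat k"
  have cnj_c: "cnj c = c" by (simp add: c_def)
  have cnj_D: "cnj (D q v) = D (\<lambda>a. cnj (q a)) v" for q v by (simp add: D_def)
  have fib: "(\<Sum>a\<in>parcs G. p (snd a) * q a) = (\<Sum>v\<in>pverts G. p v * D q v)" for p q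
    unfolding D_def by (rule sum_parcs_by_head)
  have "(\<Sum>a\<in>parcs G. step g a * cnj (step h a)) =
      (\<Sum>a\<in>parcs G. step g (prod.swap a) * cnj (step h (prod.swap a)))"
    by (rule sum.reindex_bij_betw[OF bij_swap, symmetric])
  also have "\<dots> = (\<Sum>a\<in>parcs G. (c * D g (snd a) - g a) * cnj (c * D h (snd a) - h a))"
    by (simp add: step_def D_def c_def)
  also have "\<dots> = (\<Sum>a\<in>parcs G. (c\<^sup>2 * D g (snd a) * cnj (D h (snd a))) * 1)
      - (\<Sum>a\<in>parcs G. (c * D g (snd a)) * cnj (h a)) - (\<Sum>a\<in>parcs G. (c * cnj (D h (snd a))) * g a)
      + (\<Sum>a\<in>parcs G. g a * cnj (h a))"
    unfolding sum_subtractf[symmetric] sum.distrib[symmetric]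
    by (intro sum.cong) (auto simp: algebra_simps power2_eq_square cnj_c)
  also have "(\<Sum>a\<in>parcs G. (c\<^sup>2 * D g (snd a) * cnj (D h (snd a))) * 1)
      = (\<Sum>v\<in>pverts G. 2 * c * D g v * cnj (D h v))"
    unfolding fib[of "\<lambda>v. c\<^sup>2 * D g v * cnj (D h v)" "\<lambda>_. 1"] using degree_pos
    by (intro sum.cong) (auto simp: D_def card_in[simplified] c_def power2_eq_square)
  also have "(\<Sum>a\<in>parcs G. (c * D g (snd a)) * cnj (h a)) = (\<Sum>v\<in>pverts G. c * D g v * cnj (D h v))"
    unfolding cnj_D by (rule fib[of "\<lambda>v. c * D g v" "\<lambda>a. cnj (h a)"])
  also have "(\<Sum>a\<in>parcs G. (c * cnj (D h (snd a))) * g a) = (\<Sum>v\<in>pverts G. c * D g v * cnj (D h v))"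
    unfolding fib[of "\<lambda>v. c * cnj (D h v)"] by (simp add: mult_ac)
  also have "(\<Sum>v\<in>pverts G. 2 * c * D g v * cnj (D h v)) - (\<Sum>v\<in>pverts G. c * D g v * cnj (D h v))
      - (\<Sum>v\<in>pverts G. c * D g v * cnj (D h v)) = 0"
    unfolding sum_subtractf[symmetric] by (intro sum.neutral) (simp add: algebra_simps)
  finally show ?thesis by simp
qed

lemma step_pow_isometry:
  "(\<Sum>a\<in>parcs G. (step ^^ m) g a * cnj ((step ^^ m) h a)) = (\<Sum>a\<in>parcs G. g a * cnj (h a))"
  by (induction m) (simp_all add: step_isometry)

text \<open>A single value is at most the Euclidean norm, which \<open>step\<close> preserves. This
  supplies the bound needed for the recurrence with a double root.\<close>

lemma step_pow_bounded:
  assumes "a \<in> parcs G"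
  shows "norm ((step ^^ m) g a) \<le> sqrt (\<Sum>b\<in>parcs G. (norm (g b))\<^sup>2)"
proof -
  have sq: "(\<Sum>b\<in>parcs G. q b * cnj (q b)) = of_real (\<Sum>b\<in>parcs G. (norm (q b))\<^sup>2)" for q
    unfolding of_real_sum by (intro sum.cong) (auto simp only: complex_norm_square)
  have "(norm ((step ^^ m) g a))\<^sup>2 \<le> (\<Sum>b\<in>parcs G. (norm ((step ^^ m) g b))\<^sup>2)"
    using assms by (intro member_le_sum) auto
  also have "\<dots> = (\<Sum>b\<in>parcs G. (norm (g b))\<^sup>2)"
    using step_pow_isometry[of m g g] unfolding sq of_real_eq_iff .
  finally show ?thesis by (rule real_le_rsqrt)
qed

lemma step_sum: "step (\<lambda>a. \<Sum>j\<in>J. c j * F j a) = (\<lambda>a. \<Sum>j\<in>J. c j * step (F j) a)"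
proof
  fix a :: "'v \<times> 'v"
  have "(\<Sum>b\<in>{b \<in> parcs G. snd b = fst a}. \<Sum>j\<in>J. c j * F j b) =
      (\<Sum>j\<in>J. c j * (\<Sum>b\<in>{b \<in> parcs G. snd b = fst a}. F j b))"
    by (subst sum.swap) (simp add: sum_distrib_left)
  then show "step (\<lambda>a. \<Sum>j\<in>J. c j * F j a) a = (\<Sum>j\<in>J. c j * step (F j) a)"
    by (simp add: step_def sum_distrib_left sum_subtractf right_diff_distrib mult_ac)
qed

lemma step_pow_sum: "(step ^^ m) (\<lambda>a. \<Sum>j\<in>J. c j * F j a) = (\<lambda>a. \<Sum>j\<in>J. c j * (step ^^ m) (F j) a)"
  by (induction m) (simp_all add: step_sum)

lemma step_pow_cong:
  assumes "\<And>b. b \<in> parcs G \<Longrightarrow> g b = h b" and "a \<in> parcs G"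
  shows "(step ^^ m) g a = (step ^^ m) h a"
  using assms(2) by (induction m arbitrary: a) (auto intro!: step_cong assms(1))

lemma step_pow_lin:
  "(step ^^ m) (\<lambda>a. c * g a + d * h a) = (\<lambda>a. c * (step ^^ m) g a + d * (step ^^ m) h a)"
  by (induction m) (auto simp: step_lin)

text \<open>On the quotient by the functions that depend only on the head plus those that depend only on
  the tail, \<open>U\<close> acts as minus the shift, whose square is the identity.\<close>

lemma even_step_pow:
  "\<exists>p q. \<forall>a\<in>parcs G. (step ^^ (2 * m)) g a = g a + p (snd a) + q (fst a)"
proof (induction m)
  case 0
  show ?case by (intro exI[of _ "\<lambda>_. 0"]) simp
next
  case (Suc m)
  then obtain p q where pq: "\<forall>a\<in>parcs G. (step ^^ (2 * m)) g a = g a + p (snd a) + q (fst a)"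
    by blast
  let ?h = "(step ^^ (2 * m)) g"
  let ?D = "\<lambda>h v. 2 / of_nat k * (\<Sum>b\<in>{b \<in> parcs G. snd b = v}. h b)"
  have "step (step ?h) a = g a + (p (snd a) - ?D ?h (snd a)) + (q (fst a) + ?D (step ?h) (fst a))"
    if "a \<in> parcs G" for a
    using pq that by (simp add: step_def[of "step ?h"]) (simp add: step_def)
  then show ?case
    by (intro exI[of _ "\<lambda>v. p v - ?D ?h v"] exI[of _ "\<lambda>v. q v + ?D (step ?h) v"]) simp
qed

text \<open>The recurrence shows that \<open>U\<close> to the power \<tau> fixes the lifts of the
  \<open>f j\<close>, hence all head lifts by \<open>span\<close>; it fixes tail lifts because these
  are the images of head lifts under \<open>step\<close>. What lies outside these lifts is settled
  by \<open>even_step_pow\<close> and the isometry.\<close>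

lemma grover_periodicI:
  fixes f :: "'j \<Rightarrow> 'v \<Rightarrow> complex" and t :: "'j \<Rightarrow> int" and \<tau> :: nat
  assumes \<tau>: "\<tau> > 0" "even \<tau>"
    and eig: "\<And>j. j \<in> J \<Longrightarrow> eigenfunction (f j) (k * cos (2 * pi * t j / \<tau>))"
    and span: "\<And>h. \<exists>c. \<forall>v\<in>pverts G. h v = (\<Sum>j\<in>J. c j * f j v)"
  shows "grover_periodic G"
proof -
  let ?P = "step ^^ \<tau>"
  have eig_fixed: "?P (\<lambda>a. f j (snd a)) a = f j (snd a)" if j: "j \<in> J" and a: "a \<in> parcs G" for j a
  proof -
    have "(step ^^ \<tau>) (\<lambda>a. f j (snd a)) a = (step ^^ 0) (\<lambda>a. f j (snd a)) a"
    proof (rule bounded_cos_recurrence_periodic[OF _ step_pow_bounded[OF a] \<tau>(2)])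
      show "(step ^^ Suc (Suc m)) (\<lambda>a. f j (snd a)) a =
        2 * of_real (cos (2 * pi * t j / \<tau>)) * (step ^^ Suc m) (\<lambda>a. f j (snd a)) a
         - (step ^^ m) (\<lambda>a. f j (snd a)) a" for m
        using step_pow_eigenfunction[OF eig[OF j] a, of m] degree_pos by simp
      show "\<tau> * (2 * pi * t j / \<tau>) = 2 * pi * t j" using \<tau> by simp
    qed
    then show ?thesis by simp
  qed
  have head_fixed: "?P (\<lambda>a. h (snd a)) a = h (snd a)" if a: "a \<in> parcs G" for h a
  proof -
    obtain c where c: "\<forall>v\<in>pverts G. h v = (\<Sum>j\<in>J. c j * f j v)" using span by blast
    have "?P (\<lambda>a. h (snd a)) a = ?P (\<lambda>a. \<Sum>j\<in>J. c j * f j (snd a)) a"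
      using c parcs_ends by (intro step_pow_cong[OF _ a]) auto
    also have "\<dots> = (\<Sum>j\<in>J. c j * f j (snd a))"
      unfolding step_pow_sum using eig_fixed a by simp
    finally show ?thesis using c parcs_ends[OF a] by simp
  qed
  have tail_fixed: "?P (\<lambda>a. h (fst a)) a = h (fst a)" if a: "a \<in> parcs G" for h a
  proof -
    have "?P (\<lambda>a. h (fst a)) a = ?P (step (\<lambda>a. h (snd a))) a"
      by (rule step_pow_cong[OF step_head[symmetric] a])
    also have "\<dots> = step (?P (\<lambda>a. h (snd a))) a"
      by (simp add: funpow_swap1)
    also have "\<dots> = step (\<lambda>a. h (snd a)) a"
      by (rule step_cong[OF head_fixed a])
    finally show ?thesis using step_head[OF a] by simp
  qed
  have "?P g a = g a" if a: "a \<in> parcs G" for g a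
  proof -
    define w where "w b = 1 * ?P g b + (-1) * g b" for b
    obtain m where "\<tau> = 2 * m" using \<tau> by blast
    \<comment> \<open>The factors \<open>1\<close> give the sum the shape to which
      \<open>step_pow_lin\<close> applies.\<close>
    then obtain p q where pq: "\<And>b. b \<in> parcs G \<Longrightarrow> w b = 1 * p (snd b) + 1 * q (fst b)"
      using even_step_pow[of m g] unfolding w_def by force
    \<comment> \<open>\<open>w\<close> is fixed by the isometry \<open>U\<^sup>\<tau>\<close>, hence orthogonal to \<open>U\<^sup>\<tau> g - g\<close>, which is \<open>w\<close> itself.\<close>
    have Pw: "?P w b = w b" if b: "b \<in> parcs G" for b
      using step_pow_cong[OF pq b] head_fixed[OF b] tail_fixed[OF b] pq[OF b]
      by (simp only: step_pow_lin)
    have "(\<Sum>b\<in>parcs G. g b * cnj (w b)) = (\<Sum>b\<in>parcs G. ?P g b * cnj (w b))"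
      using step_pow_isometry[of \<tau> g w] Pw by simp
    then have "(\<Sum>b\<in>parcs G. w b * cnj (w b)) = 0"
      by (simp add: w_def[of "_ :: 'v \<times> 'v"] left_diff_distrib sum_subtractf)
    then have "complex_of_real (\<Sum>b\<in>parcs G. (norm (w b))\<^sup>2) = 0"
      by (simp only: of_real_sum complex_norm_square)
    then have "(norm (w a))\<^sup>2 = 0"
      using a by (subst (asm) of_real_eq_0_iff) (simp only: sum_nonneg_eq_0_iff[OF finite_parcs zero_le_power2])
    then show ?thesis by (simp add: w_def)
  qed
  then show ?thesis using \<tau> by (auto simp: grover_periodic_iff)
qed

end

section \<open>The spectrum of quadratic unitary Cayley graphs\<close>

definition frac_cis :: "int \<Rightarrow> int \<Rightarrow> complex" where
  "frac_cis n x = cis (2 * pi * of_int x / of_int n)"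

definition frac_cos :: "int \<Rightarrow> int \<Rightarrow> real" where
  "frac_cos n x = cos (2 * pi * of_int x / of_int n)"

lemma Re_frac_cis: "Re (frac_cis n x) = frac_cos n x"
  by (simp add: frac_cis_def frac_cos_def)

lemma frac_cis_add: "frac_cis n (x + y) = frac_cis n x * frac_cis n y"
  by (simp add: frac_cis_def cis_mult add_divide_distrib distrib_left)

lemma frac_cis_cnj: "cnj (frac_cis n x) = frac_cis n (- x)"
  by (simp add: frac_cis_def cis_cnj)

lemma frac_cis_cong:
  assumes "n \<noteq> 0" "[x = y] (mod n)"
  shows "frac_cis n x = frac_cis n y"
proof -
  obtain q where q: "x = y + n * q"
    using assms(2) by (metis cong_iff_lin cong_sym)
  have "2 * pi * of_int x / of_int n = 2 * pi * of_int y / of_int n + 2 * pi * of_int q"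
    using assms(1) by (simp add: q field_simps)
  then show ?thesis
    by (simp add: frac_cis_def cis_mult[symmetric])
qed

lemma frac_cos_cong: "n \<noteq> 0 \<Longrightarrow> [x = y] (mod n) \<Longrightarrow> frac_cos n x = frac_cos n y"
  using frac_cis_cong[of n x y] by (metis Re_frac_cis)

lemma frac_cos_minus [simp]: "frac_cos n (- x) = frac_cos n x"
  by (simp add: frac_cos_def mult.assoc)

lemma frac_cos_cancel: "c \<noteq> 0 \<Longrightarrow> frac_cos (n * c) (x * c) = frac_cos n x"
  by (simp add: frac_cos_def mult.assoc)

lemma frac_cos_add_diff: "frac_cos n (x + y) + frac_cos n (x - y) = 2 * frac_cos n x * frac_cos n y"
  by (simp add: frac_cos_def distrib_left add_divide_distrib cos_add cos_diff right_diff_distrib diff_divide_distrib)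

lemma frac_cis_eq_1_iff:
  assumes "n \<noteq> 0"
  shows "frac_cis n x = 1 \<longleftrightarrow> n dvd x"
proof
  assume "n dvd x"
  then have "[x = 0] (mod n)" by (simp add: cong_0_iff)
  then show "frac_cis n x = 1" using frac_cis_cong[OF assms] by (simp add: frac_cis_def)
next
  assume "frac_cis n x = 1"
  then have "cos (2 * pi * of_int x / of_int n) = 1" by (simp add: frac_cis_def complex_eq_iff)
  then obtain q :: int where "2 * pi * of_int x / of_int n = of_int q * 2 * pi"
    by (auto simp: cos_one_2pi_int)
  then have "of_int x = (of_int (n * q) :: real)" using assms by (simp add: field_simps)
  then show "n dvd x" by (simp only: of_int_eq_iff dvd_triv_left)
qed

lemma frac_cos_eq_1_iff: "n \<noteq> 0 \<Longrightarrow> frac_cos n x = 1 \<longleftrightarrow> n dvd x"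
proof
  assume n: "n \<noteq> 0" and c: "frac_cos n x = 1"
  then have "sin (2 * pi * of_int x / of_int n) = 0"
    by (simp add: frac_cos_def cos_one_sin_zero)
  then have "frac_cis n x = 1" using c by (simp add: frac_cis_def frac_cos_def complex_eq_iff)
  then show "n dvd x" using frac_cis_eq_1_iff[OF n] by simp
next
  assume "n \<noteq> 0" "n dvd x"
  then show "frac_cos n x = 1" using frac_cis_eq_1_iff[of n x] by (metis Re_frac_cis one_complex.simps(1))
qed

lemma frac_cis_mult_nat: "frac_cis n (int m * x) = frac_cis n x ^ m"
  by (induction m) (simp_all add: frac_cis_add distrib_right, simp add: frac_cis_def)

text \<open>For \<open>x\<close> not divisible by \<open>n\<close> this is a geometric sum whose
  ratio is an n-th root of unity different from 1.\<close>

lemma sum_frac_cis: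
  assumes "n > 0"
  shows "(\<Sum>j<nat n. frac_cis n (int j * x)) = (if n dvd x then of_int n else 0)"
proof (cases "n dvd x")
  case True
  then have "frac_cis n x = 1" using frac_cis_eq_1_iff[of n x] assms by simp
  then show ?thesis using True assms by (simp add: frac_cis_mult_nat)
next
  case False
  then have "frac_cis n x \<noteq> 1" using frac_cis_eq_1_iff[of n x] assms by simp
  moreover have "frac_cis n x ^ nat n = 1"
    using frac_cis_mult_nat[of n "nat n" x, symmetric] frac_cis_eq_1_iff[of n "n * x"] assms by simp
  ultimately show ?thesis using False by (simp add: frac_cis_mult_nat sum_gp_strict)
qed

text \<open>The adjacency eigenvalue belonging to the character with index \<open>a\<close>. Cosines
  suffice because the connection set is closed under negation, so the imaginary parts
  cancel.\<close>

definition quadratic_spectrum :: "int \<Rightarrow> int \<Rightarrow> real" where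
  "quadratic_spectrum n a = (\<Sum>s\<in>quadratic_connection_set n. frac_cos n (a * s))"

section \<open>The connection set, its symmetries and the eigenvalues of the graph\<close>

locale quadratic_Cayley =
  fixes n :: int
  assumes n_ge_2: "n \<ge> 2"
begin

abbreviation "V \<equiv> quadratic_connection_set n"
abbreviation "\<G> \<equiv> quadratic_unitary_Cayley_graph n"

lemma n_pos: "n > 0" "n \<noteq> 0"
  using n_ge_2 by auto

sublocale residues n "residue_ring n"
  using n_ge_2 by unfold_locales auto

text \<open>Replaces the operations of the residue ring by integer congruences, the form in which
  the connection set is used below.\<close>

lemma connection_set_iff:
  "s \<in> V \<longleftrightarrow> 0 \<le> s \<and> s < n \<and> (\<exists>r. coprime r n \<and> ([s = r\<^sup>2] (mod n) \<or> [s = - r\<^sup>2] (mod n)))"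
proof -
  have Q: "quadratic_units n = {r\<^sup>2 mod n | r. coprime r n}"
  proof (intro equalityI subsetI)
    fix q assume "q \<in> quadratic_units n"
    then obtain r where r: "r \<in> Units (residue_ring n)" "q = r [^]\<^bsub>residue_ring n\<^esub> (2::nat)"
      by (auto simp: quadratic_units_def)
    then have "0 < r" "r < n" "coprime r n" by (auto simp: res_units_eq)
    then show "q \<in> {r\<^sup>2 mod n | r. coprime r n}"
      using r pow_cong[of r 2] by auto
  next
    fix q assume "q \<in> {r\<^sup>2 mod n | r. coprime r n}"
    then obtain r where r: "coprime r n" "q = r\<^sup>2 mod n" by blast
    have "\<not> n dvd r" using coprime_common_divisor[OF r(1), of n] n_ge_2 by auto
    then have "r mod n \<noteq> 0" by (simp add: dvd_eq_mod_eq_0)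
    then have "0 < r mod n" using n_pos by (simp add: order_less_le)
    then have "r mod n \<in> Units (residue_ring n)"
      using r(1) n_pos by (simp add: res_units_eq coprime_mod_left_iff)
    then show "q \<in> quadratic_units n"
      unfolding quadratic_units_def r(2) pow_cong[of r 2, symmetric] by blast
  qed
  have N: "V = quadratic_units n \<union> {(- q) mod n | q. q \<in> quadratic_units n}"
    by (simp add: quadratic_connection_set_def res_neg_eq)
  show ?thesis
  proof
    assume "s \<in> V"
    then obtain r where "coprime r n" "s = r\<^sup>2 mod n \<or> s = (- (r\<^sup>2 mod n)) mod n"
      unfolding N Q by blast
    then show "0 \<le> s \<and> s < n \<and> (\<exists>r. coprime r n \<and> ([s = r\<^sup>2] (mod n) \<or> [s = - r\<^sup>2] (mod n)))"
      using n_pos by (auto simp: cong_def mod_minus_eq)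
  next
    assume "0 \<le> s \<and> s < n \<and> (\<exists>r. coprime r n \<and> ([s = r\<^sup>2] (mod n) \<or> [s = - r\<^sup>2] (mod n)))"
    then obtain r where r: "coprime r n" "s = r\<^sup>2 mod n \<or> s = (- (r\<^sup>2)) mod n" "s = s mod n"
      by (auto simp: cong_def)
    then have "s = r\<^sup>2 mod n \<or> s = (- (r\<^sup>2 mod n)) mod n"
      by (auto simp: mod_minus_eq)
    then show "s \<in> V" unfolding N Q using r(1) by blast
  qed
qed

lemma finite_V [simp]: "finite V"
  by (rule finite_subset[of _ "{0..<n}"]) (auto simp: connection_set_iff)

lemma connection_setI:
  assumes "s \<in> V" "coprime u n" "[x = u\<^sup>2 * s] (mod n) \<or> [x = - (u\<^sup>2 * s)] (mod n)"
  shows "x mod n \<in> V"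
proof -
  obtain r where r: "coprime r n" "[s = r\<^sup>2] (mod n) \<or> [s = - r\<^sup>2] (mod n)"
    using assms(1) by (auto simp: connection_set_iff)
  have "[u\<^sup>2 * s = (u * r)\<^sup>2] (mod n) \<or> [u\<^sup>2 * s = - (u * r)\<^sup>2] (mod n)"
    using r(2) cong_scalar_left[of s _ n "u\<^sup>2"] by (fastforce simp: power_mult_distrib)
  moreover have "[- (u\<^sup>2 * s) = - (u * r)\<^sup>2] (mod n) \<or> [- (u\<^sup>2 * s) = (u * r)\<^sup>2] (mod n)"
    using calculation cong_minus_minus_iff[of "u\<^sup>2 * s" "(u * r)\<^sup>2" n]
      cong_minus_minus_iff[of "u\<^sup>2 * s" "- (u * r)\<^sup>2" n] by auto
  ultimately have "[x = (u * r)\<^sup>2] (mod n) \<or> [x = - (u * r)\<^sup>2] (mod n)"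
    using assms(3) cong_trans by blast
  moreover have "coprime (u * r) n" using assms(2) r(1) by simp
  ultimately have "0 \<le> x mod n \<and> x mod n < n \<and> coprime (u * r) n \<and>
      ([x mod n = (u * r)\<^sup>2] (mod n) \<or> [x mod n = - (u * r)\<^sup>2] (mod n))"
    using n_pos by simp
  then show ?thesis unfolding connection_set_iff by blast
qed

lemma one_V: "1 \<in> V"
  using n_ge_2 by (auto simp: connection_set_iff intro!: exI[of _ 1])

lemma card_V_pos: "card V > 0"
  using one_V by (auto simp: card_gt_0_iff)

lemma bij_V_square:
  assumes "coprime u n"
  shows "bij_betw (\<lambda>s. u\<^sup>2 * s mod n) V V"
proof -
  have "inj_on (\<lambda>s. u\<^sup>2 * s mod n) V"
  proof (rule inj_onI)
    fix s t assume s: "s \<in> V" "t \<in> V" and "u\<^sup>2 * s mod n = u\<^sup>2 * t mod n"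
    then have "[s = t] (mod n)" using assms by (simp add: cong_def[symmetric] cong_mult_lcancel)
    then show "s = t" using s by (auto simp: connection_set_iff cong_def)
  qed
  moreover have "(\<lambda>s. u\<^sup>2 * s mod n) ` V \<subseteq> V"
    using assms by (auto intro: connection_setI)
  ultimately show ?thesis by (simp add: bij_betw_def endo_inj_surj)
qed

lemma bij_V_minus: "bij_betw (\<lambda>s. (- s) mod n) V V"
proof -
  have "inj_on (\<lambda>s. (- s) mod n) V"
  proof (rule inj_onI)
    fix s t assume s: "s \<in> V" "t \<in> V" and "(- s) mod n = (- t) mod n"
    then have "[s = t] (mod n)" by (simp add: cong_def[symmetric] cong_minus_minus_iff)
    then show "s = t" using s by (auto simp: connection_set_iff cong_def)
  qed
  moreover have "(\<lambda>s. (- s) mod n) ` V \<subseteq> V"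
    by (auto intro: connection_setI[where u = 1])
  ultimately show ?thesis by (simp add: bij_betw_def endo_inj_surj)
qed

text \<open>Multiplication by the square of a unit permutes the connection set, so it only reorders
  the sum.\<close>

lemma spectrum_square:
  assumes "coprime u n"
  shows "quadratic_spectrum n (a * u\<^sup>2) = quadratic_spectrum n a"
proof -
  have "quadratic_spectrum n a = (\<Sum>s\<in>V. frac_cos n (a * (u\<^sup>2 * s mod n)))"
    unfolding quadratic_spectrum_def by (rule sum.reindex_bij_betw[OF bij_V_square[OF assms], symmetric])
  also have "\<dots> = quadratic_spectrum n (a * u\<^sup>2)"
    unfolding quadratic_spectrum_def
    by (intro sum.cong refl frac_cos_cong n_pos) (simp add: cong_def mod_mult_right_eq mult.assoc)
  finally show ?thesis ..
qed

lemma sum_frac_cis_V: "(\<Sum>s\<in>V. frac_cis n (a * s)) = of_real (quadratic_spectrum n a)"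
proof -
  have "(\<Sum>s\<in>V. frac_cis n (a * s)) = (\<Sum>s\<in>V. frac_cis n (a * (- s mod n)))"
    by (rule sum.reindex_bij_betw[OF bij_V_minus, symmetric])
  also have "\<dots> = (\<Sum>s\<in>V. cnj (frac_cis n (a * s)))"
    unfolding frac_cis_cnj
    by (intro sum.cong refl frac_cis_cong n_pos) (simp add: cong_def mod_mult_right_eq)
  also have "\<dots> = cnj (\<Sum>s\<in>V. frac_cis n (a * s))" by simp
  finally have "Im (\<Sum>s\<in>V. frac_cis n (a * s)) = 0"
    by (metis complex_cnj_cancel_iff complex_is_Real_iff Reals_cnj_iff)
  moreover have "Re (\<Sum>s\<in>V. frac_cis n (a * s)) = quadratic_spectrum n a"
    by (simp add: quadratic_spectrum_def Re_frac_cis)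
  ultimately show ?thesis by (simp add: complex_eq_iff)
qed

lemma pverts_Cayley: "pverts \<G> = {0..<n}"
  by (auto simp: quadratic_unitary_Cayley_graph_def res_carrier_eq)

lemma parcs_Cayley: "parcs \<G> = {(u, v). u \<in> {0..<n} \<and> v \<in> {0..<n} \<and> (u - v) mod n \<in> V}"
  by (auto simp: quadratic_unitary_Cayley_graph_def res_carrier_eq a_minus_def res_neg_eq res_add_eq mod_simps)

lemma bij_in_arcs:
  assumes v: "v \<in> pverts \<G>"
  shows "bij_betw (\<lambda>s. ((v + s) mod n, v)) V {b \<in> parcs \<G>. snd b = v}"
proof (rule bij_betw_byWitness[where f' = "\<lambda>b. (fst b - snd b) mod n"])
  have V: "s mod n = s" if "s \<in> V" for s using that by (auto simp: connection_set_iff)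
  show "\<forall>s\<in>V. (fst ((v + s) mod n, v) - snd ((v + s) mod n, v)) mod n = s"
    using V by (simp add: mod_simps)
  show "\<forall>b\<in>{b \<in> parcs \<G>. snd b = v}. ((v + (fst b - snd b) mod n) mod n, v) = b"
    by (auto simp: parcs_Cayley mod_simps)
  show "(\<lambda>s. ((v + s) mod n, v)) ` V \<subseteq> {b \<in> parcs \<G>. snd b = v}"
    using v n_pos V by (auto simp: parcs_Cayley pverts_Cayley mod_simps)
  show "(\<lambda>b. (fst b - snd b) mod n) ` {b \<in> parcs \<G>. snd b = v} \<subseteq> V"
    by (auto simp: parcs_Cayley)
qed

sublocale graph: regular_pair_graph \<G> "card V"
proof (intro regular_pair_graph.intro regular_pair_graph_axioms.intro)
  show "pair_graph \<G>" by (rule quadratic_unitary_Cayley_graph_simple[OF n_ge_2])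
  show "in_degree (with_proj \<G>) x = card V" if "x \<in> pverts \<G>" for x
    using bij_betw_same_card[OF bij_in_arcs[OF that]] by (simp add: in_degree_def in_arcs_def)
qed (rule card_V_pos)

text \<open>Characters diagonalise a Cayley graph: the neighbour \<open>v + s\<close> of
  \<open>v\<close> contributes the value at \<open>v\<close> times the value at
  \<open>s\<close>.\<close>

lemma eigenfunction_frac_cis: "graph.eigenfunction (\<lambda>v. frac_cis n (j * v)) (quadratic_spectrum n j)"
  unfolding graph.eigenfunction_def
proof
  fix v assume v: "v \<in> pverts \<G>"
  have "(\<Sum>b\<in>{b \<in> parcs \<G>. snd b = v}. frac_cis n (j * fst b)) = (\<Sum>s\<in>V. frac_cis n (j * ((v + s) mod n)))"
    using sum.reindex_bij_betw[OF bij_in_arcs[OF v], of "\<lambda>b. frac_cis n (j * fst b)"] by simp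
  also have "\<dots> = (\<Sum>s\<in>V. frac_cis n (j * s) * frac_cis n (j * v))"
    unfolding frac_cis_add[symmetric]
    by (intro sum.cong refl frac_cis_cong n_pos) (simp add: cong_def mod_mult_right_eq algebra_simps)
  also have "\<dots> = of_real (quadratic_spectrum n j) * frac_cis n (j * v)"
    by (simp add: sum_distrib_right[symmetric] sum_frac_cis_V)
  finally show "(\<Sum>b\<in>{b \<in> parcs \<G>. snd b = v}. frac_cis n (j * fst b)) =
      of_real (quadratic_spectrum n j) * frac_cis n (j * v)" .
qed

lemma algebraic_int_spectrum:
  assumes "grover_periodic \<G>"
  shows "algebraic_int (complex_of_real (2 * quadratic_spectrum n j / card V))"
  by (rule graph.algebraic_int_of_periodic[OF assms eigenfunction_frac_cis, of 0 j])
    (use n_pos in \<open>auto simp: pverts_Cayley frac_cis_def\<close>)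

text \<open>Fourier inversion on the integers modulo \<open>n\<close>, by orthogonality of the
  characters.\<close>

lemma frac_cis_span:
  "\<exists>c. \<forall>v\<in>pverts \<G>. h v = (\<Sum>j<nat n. c j * frac_cis n (int j * v))"
proof (intro exI ballI)
  fix v assume v: "v \<in> pverts \<G>"
  have "(\<Sum>j<nat n. (\<Sum>w\<in>{0..<n}. h w * frac_cis n (- (int j * w)) / of_int n) * frac_cis n (int j * v)) =
      (\<Sum>w\<in>{0..<n}. h w / of_int n * (\<Sum>j<nat n. frac_cis n (int j * (v - w))))"
    unfolding sum_distrib_left sum_distrib_right
    by (subst sum.swap) (simp add: right_diff_distrib frac_cis_add[of _ _ "- _", simplified] mult_ac)
  also have "\<dots> = (\<Sum>w\<in>{0..<n}. if w = v then h w else 0)"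
  proof (intro sum.cong refl)
    fix w assume w: "w \<in> {0..<n}"
    have "n dvd v - w \<longleftrightarrow> w = v"
      using v w by (auto simp: pverts_Cayley mod_eq_dvd_iff[symmetric])
    then show "h w / of_int n * (\<Sum>j<nat n. frac_cis n (int j * (v - w))) = (if w = v then h w else 0)"
      using n_pos by (simp add: sum_frac_cis)
  qed
  also have "\<dots> = h v" using v by (simp add: pverts_Cayley)
  finally show "h v = (\<Sum>j<nat n. (\<Sum>w\<in>{0..<n}. h w * frac_cis n (- (int j * w)) / of_int n) * frac_cis n (int j * v))"
    by simp
qed

text \<open>\<open>N\<close> itself serves as a period: the characters are a spanning family of
  eigenfunctions, and all eigenvalues divided by the degree are cosines of multiples of 2 pi /
  N.\<close>

lemma periodic_of_spectrum:
  assumes N: "N > 0" "even N"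
    and spec: "\<And>j. \<exists>t. quadratic_spectrum n j = card V * frac_cos (int N) t"
  shows "grover_periodic \<G>"
proof -
  obtain t where t: "quadratic_spectrum n j = card V * frac_cos (int N) (t j)" for j
    using spec by metis
  show ?thesis
  proof (rule graph.grover_periodicI[OF N _ frac_cis_span])
    show "graph.eigenfunction (\<lambda>v. frac_cis n (int j * v)) (card V * cos (2 * pi * t (int j) / N))" for j
      using eigenfunction_frac_cis[of "int j"] t[of "int j"] by (simp add: frac_cos_def mult.assoc)
  qed
qed

end

section \<open>Residues and cosine sums\<close>

lemma coprime_int_if_no_prime:
  fixes a b :: int
  assumes "b \<noteq> 0" and "\<And>p. prime p \<Longrightarrow> p dvd a \<Longrightarrow> p dvd b \<Longrightarrow> False"
  shows "coprime a b"
proof (rule coprimeI)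
  fix c assume c: "c dvd a" "c dvd b"
  show "is_unit c"
  proof (rule ccontr)
    assume "\<not> is_unit c"
    moreover have "c \<noteq> 0" using c(2) assms(1) by auto
    ultimately obtain p where "p dvd c" "prime p" using prime_divisor_exists by blast
    then show False using assms(2) c dvd_trans by blast
  qed
qed

text \<open>Add to \<open>b\<close> the product of \<open>m\<close> and all prime factors of
  \<open>n\<close> that do not divide \<open>b\<close>. A prime factor of \<open>n\<close> then
  divides exactly one of the two summands: \<open>b\<close> or this product.\<close>

lemma exists_coprime_cong:
  fixes b m n :: int
  assumes "coprime b m" "n \<noteq> 0"
  shows "\<exists>r. [r = b] (mod m) \<and> coprime r n"
proof (intro exI conjI)
  define P where "P = {p \<in> prime_factors n. \<not> p dvd b}"
  have fin: "finite P" by (simp add: P_def)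
  let ?r = "b + m * \<Prod>P"
  show "[?r = b] (mod m)" by (simp add: cong_iff_dvd_diff)
  show "coprime ?r n"
  proof (rule coprime_int_if_no_prime[OF assms(2)])
    fix p :: int assume p: "prime p" "p dvd ?r" "p dvd n"
    show False
    proof (cases "p dvd b")
      case True
      then have "p dvd m * \<Prod>P" using p(2) by (simp add: dvd_add_right_iff)
      moreover have "\<not> p dvd m"
        using True assms(1) p(1) by (metis coprime_common_divisor not_prime_unit)
      ultimately have "p dvd \<Prod>P" using p(1) prime_dvd_mult_iff by blast
      then obtain q where q: "q \<in> P" "p dvd q" using prime_dvd_prod_iff[OF fin p(1), of "\<lambda>x. x"] by auto
      then have "p = q" using p(1) by (simp add: P_def primes_dvd_imp_eq in_prime_factors_iff)
      then show False using q True by (simp add: P_def)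
    next
      case False
      then have "p \<in> P" using p assms(2) by (simp add: P_def in_prime_factors_iff)
      then have "p dvd \<Prod>P" using fin dvd_prodI[of P p "\<lambda>x. x"] by simp
      then have "p dvd b" using p(2) by (simp add: dvd_add_left_iff)
      then show False using False by simp
    qed
  qed
qed

lemma coprime_dvd_modulus: "coprime r n \<Longrightarrow> m dvd n \<Longrightarrow> coprime r m" for r m n :: int
  by (metis coprime_mult_right_iff dvdE)

lemma dvd_two_prime_powers:
  fixes d :: int
  assumes pq: "prime p" "prime q" and d: "d dvd p ^ a * q ^ b" "d > 0"
  obtains x y where "x \<le> a" "y \<le> b" "d = p ^ x * q ^ y"
proof -
  obtain e f where ef: "d = e * f" "e dvd p ^ a" "f dvd q ^ b"
    using division_decomp[OF d(1)] by blast
  obtain x where x: "x \<le> a" "normalize e = normalize (p ^ x)"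
    using divides_primepow_weak[OF pq(1) ef(2)] .
  obtain y where y: "y \<le> b" "normalize f = normalize (q ^ y)"
    using divides_primepow_weak[OF pq(2) ef(3)] .
  have "d = \<bar>e\<bar> * \<bar>f\<bar>" using ef(1) d(2) by (simp add: abs_mult[symmetric])
  also have "\<dots> = p ^ x * q ^ y"
    using x(2) y(2) pq by (simp add: prime_ge_0_int)
  finally show ?thesis using x(1) y(1) that by blast
qed

section \<open>Squares of units for small moduli and explicit cosine sums\<close>

lemma frac_cos_dvd: "n \<noteq> 0 \<Longrightarrow> n dvd x - y \<Longrightarrow> frac_cos n x = frac_cos n y"
  by (simp add: frac_cos_cong cong_iff_dvd_diff)

text \<open>Reduces a statement about squares of units to an evaluation over all residues.
  \<open>D\<close> lists divisors of \<open>m\<close> that sieve out residues not coprime to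
  \<open>m\<close>, and \<open>Q\<close> lists the permitted squares.\<close>

lemma square_residue:
  fixes r m :: int
  assumes "coprime r m" "m > 0" and
   "\<forall>j\<in>set [0..m - 1]. (\<forall>d\<in>set D. \<not> d dvd j) \<longrightarrow> j\<^sup>2 mod m \<in> set Q"
    and "\<forall>d\<in>set D. d dvd m \<and> d > 1"
  shows "r\<^sup>2 mod m \<in> set Q"
proof -
  have "r mod m \<in> set [0..m - 1]" using assms(2) by simp
  moreover have "\<not> d dvd r mod m" if "d \<in> set D" for d
    using coprime_common_divisor[OF assms(1), of d] assms(4) that by (auto simp: dvd_mod_iff)
  ultimately show ?thesis using assms(3) by (metis power_mod)
qed
lemma squares_mod_15: "r\<^sup>2 mod 15 \<in> {1, 4}" if "coprime r 15" for r :: int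
  using square_residue[OF that, of "[3, 5]" "[1, 4]"] by (simp add: upto.simps)
lemma squares_mod_40: "r\<^sup>2 mod 40 \<in> {1, 9}" if "coprime r 40" for r :: int
  using square_residue[OF that, of "[2, 5]" "[1, 9]"] by (simp add: upto.simps)
lemma squares_mod_24: "r\<^sup>2 mod 24 = 1" if "coprime r 24" for r :: int
  using square_residue[OF that, of "[2, 3]" "[1]"] by (simp add: upto.simps)
lemma squares_mod_20: "r\<^sup>2 mod 20 \<in> {1, 9}" if "coprime r 20" for r :: int
  using square_residue[OF that, of "[2, 5]" "[1, 9]"] by (simp add: upto.simps)

lemma sum_frac_cos: "n > 0 \<Longrightarrow> \<not> n dvd x \<Longrightarrow> (\<Sum>j<nat n. frac_cos n (int j * x)) = 0"
  using arg_cong[OF sum_frac_cis[of n x], of Re] by (simp add: Re_frac_cis)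

lemma sum_fifths: "2 * (frac_cos 5 1 + frac_cos 5 2) = -1"
proof -
  have "frac_cos 5 4 = frac_cos 5 (-1)" "frac_cos 5 3 = frac_cos 5 (-2)"
    by (intro frac_cos_dvd; simp)+
  moreover have "frac_cos 5 0 = 1" by (simp add: frac_cos_def)
  ultimately show ?thesis
    using sum_frac_cos[of 5 1] by (simp add: lessThan_nat_numeral)
qed

text \<open>Up to sign, 1, 4, 7 and 28 represent the units modulo 15, so this is half the sum of the
  primitive fifteenth roots of unity. It is found by removing the roots of order 1, 3 and 5 from the
  vanishing sum of all. The term 28 is 7 * 2^2, as produced by
  \<open>periodic_two_terms\<close>.\<close>

lemma sum_fifteenths: "frac_cos 15 1 + frac_cos 15 4 + (frac_cos 15 7 + frac_cos 15 28) = 1 / 2"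
proof -
  have sym: "frac_cos 15 14 = frac_cos 15 (-1)" "frac_cos 15 13 = frac_cos 15 (-2)"
    "frac_cos 15 12 = frac_cos 15 (-3)" "frac_cos 15 11 = frac_cos 15 (-4)"
    "frac_cos 15 10 = frac_cos 15 (-5)" "frac_cos 15 9 = frac_cos 15 (-6)"
    "frac_cos 15 8 = frac_cos 15 (-7)" "frac_cos 15 28 = frac_cos 15 (-2)" "frac_cos 3 2 = frac_cos 3 (-1)"
    by (intro frac_cos_dvd; simp)+
  have zero: "frac_cos 15 0 = 1" "frac_cos 3 0 = 1" by (simp_all add: frac_cos_def)
  have "frac_cos 15 3 = frac_cos 5 1" "frac_cos 15 6 = frac_cos 5 2" "frac_cos 15 5 = frac_cos 3 1"
    using frac_cos_cancel[of 3 5 1] frac_cos_cancel[of 3 5 2] frac_cos_cancel[of 5 3 1] by simp_all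
  then show ?thesis
    using sum_frac_cos[of 15 1] sum_frac_cos[of 3 1] sum_fifths sym zero by (simp add: lessThan_nat_numeral)
qed

text \<open>Expand the squares into cosines of sums and differences. Reflection at a half turn makes
  the term at 10 vanish and cancels 2 against 18 and 6 against 14; what remains is 2 plus the two
  cosines of \<open>sum_fifths\<close>.\<close>

lemma sum_fortieths:
  "(frac_cos 40 1 + frac_cos 40 9)\<^sup>2 + (frac_cos 40 3 + frac_cos 40 27)\<^sup>2 = 3 / 2"
proof -
  let ?y = "frac_cos 40"
  have half: "?y x = - ?y (20 - x)" for x
  proof -
    have "2 * pi * of_int (20 - x) / of_int 40 = pi - 2 * pi * of_int x / of_int 40"
      by (simp add: field_simps)
    then show ?thesis by (simp only: frac_cos_def cos_pi_minus minus_minus)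
  qed
  have prod: "2 * ?y x * ?y z = ?y (x + z) + ?y (x - z)" for x z
    by (rule frac_cos_add_diff[symmetric])
  have "?y 0 = 1" by (simp add: frac_cos_def)
  then have "2 * (?y 1)\<^sup>2 = ?y 2 + 1" "2 * (?y 9)\<^sup>2 = ?y 18 + 1" "2 * (?y 3)\<^sup>2 = ?y 6 + 1"
    "2 * (?y 27)\<^sup>2 = ?y 54 + 1" "2 * ?y 9 * ?y 1 = ?y 10 + ?y 8" "2 * ?y 27 * ?y 3 = ?y 30 + ?y 24"
    using prod[of 1 1] prod[of 9 9] prod[of 3 3] prod[of 27 27] prod[of 9 1] prod[of 27 3]
    by (simp_all add: power2_eq_square)
  moreover have "?y 54 = ?y 14" "?y 24 = ?y (-16)" "?y 30 = ?y (-10)"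
    by (intro frac_cos_dvd; simp)+
  moreover have "?y 10 = 0" "?y 18 = - ?y 2" "?y 14 = - ?y 6"
    using half[of 10] half[of 18] half[of 14] by simp_all
  moreover have "?y 8 = frac_cos 5 1" "?y 16 = frac_cos 5 2"
    using frac_cos_cancel[of 8 5 1] frac_cos_cancel[of 8 5 2] by simp_all
  ultimately show ?thesis
    using sum_fifths by (simp add: power2_sum mult_ac)
qed

lemma algebraic_int_fraction:
  fixes a b :: int
  assumes "algebraic_int (complex_of_real (of_int a / of_int b))" "b \<noteq> 0"
  shows "b dvd a"
proof -
  have "(of_int a / of_int b :: real) \<in> \<int>"
  proof (rule rational_algebraic_int_is_int)
    show "algebraic_int (of_int a / of_int b :: real)"
      using assms(1) by (simp only: algebraic_int_of_real_iff)
  qed simp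
  then obtain q where "(of_int a / of_int b :: real) = of_int q" by (auto elim: Ints_cases)
  then have "(of_int a :: real) = of_int (b * q)" using assms(2) by (simp add: field_simps)
  then show ?thesis by (simp only: of_int_eq_iff dvd_triv_left)
qed

section \<open>Obstructions to periodicity\<close>

context quadratic_Cayley
begin

text \<open>The square root is chosen coprime to an auxiliary \<open>N\<close> as well, so that
  facts about squares modulo 24 or 20 apply even if \<open>n\<close> lacks some of their prime
  factors.\<close>

lemma connection_set_lift:
  assumes "s \<in> V" "N \<noteq> 0"
  obtains r e where "coprime r n" "coprime r N" "e = 1 \<or> e = -1" "n dvd s - e * r\<^sup>2"
proof -
  obtain r where r: "coprime r n" "[s = r\<^sup>2] (mod n) \<or> [s = - r\<^sup>2] (mod n)"
    using assms(1) by (auto simp: connection_set_iff)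
  obtain t where t: "[t = r] (mod n)" "coprime t (n * N)"
    using exists_coprime_cong[OF r(1), of "n * N"] n_pos assms(2) by auto
  have "[t\<^sup>2 = r\<^sup>2] (mod n)" using t(1) by (rule cong_pow)
  then have "[s = t\<^sup>2] (mod n) \<or> [s = - t\<^sup>2] (mod n)"
    using r(2) by (metis cong_minus_minus_iff cong_sym cong_trans)
  then have "n dvd s - 1 * t\<^sup>2 \<or> n dvd s - (-1) * t\<^sup>2" by (simp add: cong_iff_dvd_diff)
  then show ?thesis using t(2) that[of t 1] that[of t "-1"] by auto
qed

lemma spectrum_constant:
  fixes c :: real
  assumes "\<And>s. s \<in> V \<Longrightarrow> frac_cos n (a * s) = c"
  shows "quadratic_spectrum n a = card V * c"
  using assms by (simp add: quadratic_spectrum_def)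

text \<open>With \<open>d = u\<^sup>2 - 1\<close>, the angles of \<open>a * s\<close>, \<open>a * u\<^sup>2 * s\<close>, \<open>a * u\<^sup>4 * s\<close> form an
  arithmetic progression whose difference is, up to sign, that of \<open>a * d\<close>. Summing
  \<open>cos (x + y) + cos (x - y) = 2 * cos x * cos y\<close> over \<open>s\<close> gives \<open>2 * \<lambda> = 2 * \<lambda> * cos y\<close> with
  \<open>cos y \<noteq> 1\<close>.\<close>

lemma spectrum_vanishes:
  assumes u: "coprime u n" and M: "M dvd u\<^sup>2 - 1" "n dvd M * (a * (u\<^sup>2 - 1))"
    and nd: "\<not> n dvd a * (u\<^sup>2 - 1)"
    and w: "\<And>s. s \<in> V \<Longrightarrow> \<exists>w. n dvd s - w \<and> (M dvd w - 1 \<or> M dvd w + 1)"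
  shows "quadratic_spectrum n a = 0"
proof -
  define d where "d = u\<^sup>2 - 1"
  have u2: "u\<^sup>2 = 1 + d" by (simp add: d_def)
  \<comment> \<open>This makes the second difference of the three angles vanish modulo
    \<open>n\<close>.\<close>
  have ndd: "n dvd a * d * d"
  proof -
    obtain q where "d = M * q" using M(1) by (auto simp: d_def)
    then have "a * d * d = M * (a * d) * q" by simp
    then show ?thesis using M(2) by (metis d_def dvd_mult2)
  qed
  have key: "frac_cos n (a * (u\<^sup>2)\<^sup>2 * s) + frac_cos n (a * s) = 2 * frac_cos n (a * u\<^sup>2 * s) * frac_cos n (a * d)"
    if s: "s \<in> V" for s
  proof -
    have "a * (u\<^sup>2)\<^sup>2 * s - (a * u\<^sup>2 * s + a * d * s) = a * d * d * s"
      unfolding u2 by (simp add: algebra_simps power2_eq_square)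
    then have 1: "frac_cos n (a * (u\<^sup>2)\<^sup>2 * s) = frac_cos n (a * u\<^sup>2 * s + a * d * s)"
      using ndd by (intro frac_cos_dvd n_pos) (simp only: dvd_mult2)
    have "a * s = a * u\<^sup>2 * s - a * d * s" unfolding u2 by (simp add: algebra_simps)
    then have 2: "frac_cos n (a * s) = frac_cos n (a * u\<^sup>2 * s - a * d * s)" by simp
    obtain w where w: "n dvd s - w" "M dvd w - 1 \<or> M dvd w + 1" using w[OF s] by blast
    \<comment> \<open>As \<open>n\<close> divides \<open>M * (a * d)\<close>, only \<open>w\<close>
      modulo \<open>M\<close> matters, and \<open>w\<close> is 1 or -1 there; the cosine ignores the
      sign.\<close>
    have "frac_cos n (a * d * s) = frac_cos n (a * d * w)"
      using w(1) n_pos by (intro frac_cos_dvd) (simp_all flip: right_diff_distrib)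
    also have "\<dots> = frac_cos n (a * d)"
      using w(2)
    proof
      assume "M dvd w - 1"
      then obtain q where "w = 1 + M * q" by (metis add_diff_cancel_left' diff_add_cancel dvdE add.commute)
      then have "a * d * w - a * d = M * (a * d) * q" by (simp add: algebra_simps)
      then show ?thesis using M(2) n_pos by (intro frac_cos_dvd) (simp_all add: d_def)
    next
      assume "M dvd w + 1"
      then obtain q where q: "w + 1 = M * q" by auto
      have "a * d * w - (- (a * d)) = a * d * (w + 1)" by (simp add: algebra_simps)
      then have "a * d * w - (- (a * d)) = M * (a * d) * q" by (simp add: q)
      then have "frac_cos n (a * d * w) = frac_cos n (- (a * d))"
        using M(2) n_pos by (intro frac_cos_dvd) (simp_all add: d_def)
      then show ?thesis by simp
    qed
    finally show ?thesis using frac_cos_add_diff[of n "a * u\<^sup>2 * s" "a * d * s"] 1 2 by simp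
  qed
  let ?l = "quadratic_spectrum n a"
  have "quadratic_spectrum n (a * (u\<^sup>2)\<^sup>2) + ?l = 2 * quadratic_spectrum n (a * u\<^sup>2) * frac_cos n (a * d)"
    unfolding quadratic_spectrum_def sum.distrib[symmetric] sum_distrib_left sum_distrib_right
    by (intro sum.cong refl) (rule key)
  then have "?l = ?l * frac_cos n (a * d)"
    using u spectrum_square[of u a] spectrum_square[of "u\<^sup>2" a] by simp
  moreover have "frac_cos n (a * d) \<noteq> 1"
    using nd n_pos by (simp add: frac_cos_eq_1_iff d_def)
  ultimately show ?thesis by simp
qed

lemma spectrum_quotient:
  assumes "n = m * c"
  shows "quadratic_spectrum n (x * c) = (\<Sum>s\<in>V. frac_cos m (x * s))"
proof -
  have "c \<noteq> 0" using assms n_pos by auto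
  then have "frac_cos n (x * c * s) = frac_cos m (x * s)" for s
    using frac_cos_cancel[of c m "x * s"] assms by (simp add: mult_ac)
  then show ?thesis by (simp add: quadratic_spectrum_def)
qed

text \<open>The eigenvalue at \<open>x * c\<close> depends on angles with denominator
  \<open>m\<close> only, so \<open>b\<close> may be replaced by a unit modulo \<open>n\<close> that
  is congruent to it modulo \<open>m\<close>.\<close>

lemma spectrum_square_quotient:
  assumes "n = m * c" "coprime b m"
  shows "quadratic_spectrum n (x * b\<^sup>2 * c) = quadratic_spectrum n (x * c)"
proof -
  obtain u where u: "[u = b] (mod m)" "coprime u n"
    using exists_coprime_cong[OF assms(2)] n_pos by blast
  have m: "m \<noteq> 0" using assms n_pos by auto
  have "[u\<^sup>2 = b\<^sup>2] (mod m)" using u(1) by (rule cong_pow)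
  then have "frac_cos m (x * b\<^sup>2 * s) = frac_cos m (x * u\<^sup>2 * s)" for s
    by (intro frac_cos_cong m cong_mult cong_refl) (rule cong_sym)
  then have "quadratic_spectrum n (x * b\<^sup>2 * c) = quadratic_spectrum n (x * c * u\<^sup>2)"
    using spectrum_quotient[OF assms(1), of "x * b\<^sup>2"] spectrum_quotient[OF assms(1), of "x * u\<^sup>2"]
    by (simp add: mult_ac)
  then show ?thesis using spectrum_square[OF u(2)] by simp
qed

text \<open>The unit squares modulo \<open>m\<close> are among 1 and b^2, and b^4 = 1. Hence for
  every \<open>s\<close> the angles of \<open>x * s\<close> and \<open>x * b\<^sup>2 * s\<close>
  are, up to sign, those of \<open>x\<close> and \<open>x * b\<^sup>2\<close> in some order. Summing
  over \<open>s\<close> gives two equal eigenvalues on the left.\<close>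

lemma spectrum_two_terms:
  assumes n: "n = m * c" and b: "coprime b m" "m dvd (b\<^sup>2)\<^sup>2 - 1"
    and sq: "\<And>r. coprime r m \<Longrightarrow> m dvd r\<^sup>2 - 1 \<or> m dvd r\<^sup>2 - b\<^sup>2"
  shows "2 * quadratic_spectrum n (x * c) / card V = frac_cos m x + frac_cos m (x * b\<^sup>2)"
proof -
  have m: "m \<noteq> 0" using n n_pos by auto
  have "frac_cos m (x * s) + frac_cos m (x * b\<^sup>2 * s) = frac_cos m x + frac_cos m (x * b\<^sup>2)"
    if s: "s \<in> V" for s
  proof -
    obtain r e where r: "coprime r n" "e = 1 \<or> e = -1" "n dvd s - e * r\<^sup>2"
      using connection_set_lift[OF s, of 1] by auto
    have "m dvd s - e * r\<^sup>2" using r(3) n by (auto dest: dvd_mult_left)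
    then have "frac_cos m (y * s) = frac_cos m (y * (e * r\<^sup>2))" for y
      using m by (intro frac_cos_dvd) (simp_all flip: right_diff_distrib)
    then have A: "frac_cos m (y * s) = frac_cos m (y * r\<^sup>2)" for y
      using r(2) by auto
    have "coprime r m" using coprime_dvd_modulus[OF r(1), of m] n by simp
    then consider "m dvd r\<^sup>2 - 1" | "m dvd r\<^sup>2 - b\<^sup>2" using sq by blast
    then show ?thesis
    proof cases
      case 1
      then have "frac_cos m (y * r\<^sup>2) = frac_cos m (y * 1)" for y
        by (intro frac_cos_dvd m) (simp only: right_diff_distrib[symmetric] dvd_mult)
      then show ?thesis by (simp add: A)
    next
      case 2
      then have B: "frac_cos m (y * r\<^sup>2) = frac_cos m (y * b\<^sup>2)" for y
        by (intro frac_cos_dvd m) (simp only: right_diff_distrib[symmetric] dvd_mult)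
      have "frac_cos m (x * b\<^sup>2 * b\<^sup>2) = frac_cos m (x * 1)"
        using b(2) by (intro frac_cos_dvd m)
          (simp only: right_diff_distrib[symmetric] mult.assoc power2_eq_square[of "b\<^sup>2", symmetric] dvd_mult)
      then show ?thesis by (simp add: A B)
    qed
  qed
  then have "(\<Sum>s\<in>V. frac_cos m (x * s) + frac_cos m (x * b\<^sup>2 * s)) = card V * (frac_cos m x + frac_cos m (x * b\<^sup>2))"
    by simp
  then have "2 * quadratic_spectrum n (x * c) = card V * (frac_cos m x + frac_cos m (x * b\<^sup>2))"
    using spectrum_square_quotient[OF n b(1), of x]
    by (simp only: sum.distrib spectrum_quotient[OF n, symmetric])
  then show ?thesis using card_V_pos by (simp add: field_simps del: card_eq_0_iff card_0_eq)
qed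

lemma periodic_two_terms:
  assumes "grover_periodic \<G>" "m dvd n" "coprime b m" "m dvd (b\<^sup>2)\<^sup>2 - 1"
    and "\<And>r. coprime r m \<Longrightarrow> m dvd r\<^sup>2 - 1 \<or> m dvd r\<^sup>2 - b\<^sup>2"
  shows "algebraic_int (complex_of_real (frac_cos m x + frac_cos m (x * b\<^sup>2)))"
proof -
  obtain c where c: "n = m * c" using assms(2) by blast
  show ?thesis
    using algebraic_int_spectrum[OF assms(1), of "x * c"] spectrum_two_terms[OF c assms(3-5), of x] by metis
qed

lemma periodic_not_15_dvd:
  assumes "grover_periodic \<G>"
  shows "\<not> 15 dvd n"
proof
  assume n: "15 dvd n"
  have "algebraic_int (complex_of_real (frac_cos 15 x + frac_cos 15 (x * 2\<^sup>2)))" for x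
  proof (rule periodic_two_terms[OF assms n])
    show "coprime 2 (15 :: int)" by simp
    show "15 dvd r\<^sup>2 - 1 \<or> 15 dvd r\<^sup>2 - 2\<^sup>2" if "coprime r 15" for r :: int
      using squares_mod_15[OF that] by (auto simp: mod_eq_dvd_iff[symmetric])
  qed simp
  from algebraic_int_add_mult(1)[OF this[of 1] this[of 7]]
  have "algebraic_int (complex_of_real (1 / 2))"
    using sum_fifteenths by (simp only: of_real_add[symmetric]) simp
  then show False using algebraic_int_fraction[of 1 2] by simp
qed

lemma periodic_not_40_dvd:
  assumes "grover_periodic \<G>"
  shows "\<not> 40 dvd n"
proof
  assume n: "40 dvd n"
  have *: "algebraic_int (complex_of_real (frac_cos 40 x + frac_cos 40 (x * 3\<^sup>2)))" for x
  proof (rule periodic_two_terms[OF assms n])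
    show "coprime 3 (40 :: int)" by (simp add: coprime_iff_gcd_eq_1 gcd_non_0_int)
    show "40 dvd r\<^sup>2 - 1 \<or> 40 dvd r\<^sup>2 - 3\<^sup>2" if "coprime r 40" for r :: int
      using squares_mod_40[OF that] by (auto simp: mod_eq_dvd_iff[symmetric])
  qed simp
  \<comment> \<open>Squaring leads to the rational sum of \<open>sum_fortieths\<close>, so closure
    under products is needed here, not only under sums.\<close>
  have "algebraic_int (complex_of_real ((frac_cos 40 x + frac_cos 40 (x * 3\<^sup>2))\<^sup>2))" for x
    using algebraic_int_add_mult(2)[OF *[of x] *[of x]] by (simp add: power2_eq_square)
  from algebraic_int_add_mult(1)[OF this[of 1] this[of 3]]
  have "algebraic_int (complex_of_real (3 / 2))"
    using sum_fortieths by (simp only: of_real_add[symmetric]) simp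
  then show False using algebraic_int_fraction[of 3 2] by simp
qed

text \<open>Let p = 2 h + 1 and sum the eigenvalues \<open>T\<close> over the powers of a primitive
  root \<open>g\<close>. Only the values \<open>T 1\<close> and \<open>T (int g)\<close> occur, each
  \<open>h\<close> times, and the total is minus the degree. So -2/h is a sum of two algebraic
  integers, which forces h to divide 2 and p to be 3 or 5.\<close>

lemma periodic_prime_dvd:
  assumes per: "grover_periodic \<G>" and p: "prime p" "p dvd n"
  shows "p \<in> {2, 3, 5}"
proof (cases "p = 2")
  case False
  define P where "P = nat p"
  have P: "prime P" "int P = p" using p(1) by (simp_all add: P_def prime_ge_0_int)
  have "P \<noteq> 2" using False P(2) by auto
  then have odd: "odd P" using P(1) by (metis primes_dvd_imp_eq two_is_prime_nat)
  obtain g where gk: "\<forall>k>0. residue_primroot (P ^ k) g"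
    using residue_primroot_odd_prime_power_exists[OF P(1) odd] .
  have g: "residue_primroot P g" using gk[rule_format, of 1] by simp
  have P1: "P > 1" using P(1) prime_gt_1_nat by blast
  obtain h where "P = 2 * h + 1" using odd by (rule oddE)
  with P1 have h: "P = 2 * h + 1" "h > 0" by simp_all
  have cop: "coprime (int g) p"
    using g P(2) by (auto simp: residue_primroot_def coprime_commute)
  obtain c where c: "n = p * c" using p(2) by blast
  define T where "T x = quadratic_spectrum n (x * c)" for x
  have T: "T x = (\<Sum>s\<in>V. frac_cos p (x * s))" for x
    unfolding T_def by (rule spectrum_quotient[OF c])
  have T2: "T (x * (int g)\<^sup>2) = T x" for x
    unfolding T_def by (rule spectrum_square_quotient[OF c cop])
  \<comment> \<open>\<open>T\<close> is invariant under multiplication by the square of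
    \<open>g\<close>, so along the powers of \<open>g\<close> it alternates between two
    values.\<close>
  have "(\<Sum>i<2 * k. T (int g ^ i)) = k * (T 1 + T (int g)) \<and>
      T (int g ^ (2 * k)) = T 1 \<and> T (int g ^ Suc (2 * k)) = T (int g)" for k
  proof (induction k)
    case (Suc k)
    have "T (int g ^ (2 * Suc k)) = T (int g ^ (2 * k))"
      using T2[of "int g ^ (2 * k)"] by (simp add: power2_eq_square mult_ac)
    moreover have "T (int g ^ Suc (2 * Suc k)) = T (int g ^ Suc (2 * k))"
      using T2[of "int g ^ Suc (2 * k)"] by (simp add: power2_eq_square mult_ac)
    ultimately show ?case using Suc by (simp add: algebra_simps)
  qed simp
  then have sum1: "(\<Sum>i<2 * h. T (int g ^ i)) = h * (T 1 + T (int g))" by blast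
  \<comment> \<open>The powers of \<open>g\<close> run through all nonzero residues and
    \<open>s\<close> is invertible modulo \<open>p\<close>, so this is the sum of all p-th roots of
    unity other than 1.\<close>
  have inner: "(\<Sum>i<2 * h. frac_cos p (int g ^ i * s)) = -1" if s: "s \<in> V" for s
  proof -
    have p0: "p \<noteq> 0" using p(1) by auto
    have "\<not> p dvd s"
    proof
      assume "p dvd s"
      obtain r e where r: "coprime r n" "e = 1 \<or> e = -1" "n dvd s - e * r\<^sup>2"
        using connection_set_lift[OF s, of 1] by auto
      have "p dvd e * r\<^sup>2" using dvd_diff[OF \<open>p dvd s\<close> dvd_trans[OF p(2) r(3)]] by simp
      then have "p dvd r" using r(2) p(1) prime_dvd_power by auto
      then show False using coprime_common_divisor[OF r(1) _ p(2)] p(1) by auto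
    qed
    then have z: "(\<Sum>j<P. frac_cos p (int j * s)) = 0"
      using sum_frac_cos[of p s] p(1) by (simp add: P_def prime_gt_0_int)
    have "(\<Sum>i<2 * h. frac_cos p (int g ^ i * s)) = (\<Sum>i<2 * h. frac_cos p (int (g ^ i mod P) * s))"
    proof (intro sum.cong refl frac_cos_cong p0 cong_mult cong_refl)
      fix i show "[int g ^ i = int (g ^ i mod P)] (mod p)"
        by (simp add: cong_def zmod_int P(2)[symmetric])
    qed
    also have "\<dots> = (\<Sum>j\<in>{0<..<P}. frac_cos p (int j * s))"
    proof -
      have "totient P = 2 * h" using totient_prime[OF P(1)] h(1) by simp
      then show ?thesis
        using sum.reindex_bij_betw[OF residue_primroot_is_generator[OF P1 g], of "\<lambda>j. frac_cos p (int j * s)"]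
        by (simp only: totatives_prime[OF P(1)])
    qed
    also have "\<dots> = (\<Sum>j<P. frac_cos p (int j * s)) - frac_cos p 0"
    proof -
      have "{..<P} = insert 0 {0<..<P}" using P1 by auto
      then show ?thesis by simp
    qed
    finally show ?thesis using z by (simp add: frac_cos_def)
  qed
  have "(\<Sum>i<2 * h. T (int g ^ i)) = (\<Sum>s\<in>V. \<Sum>i<2 * h. frac_cos p (int g ^ i * s))"
    unfolding T by (rule sum.swap)
  also have "\<dots> = - card V" by (simp add: inner)
  finally have hT: "h * (T 1 + T (int g)) = - real (card V)"
    using sum1 by simp
  have "(2 * T 1 + 2 * T (int g)) / card V = (- 2) / real h"
  proof (subst frac_eq_eq)
    have "(2 * T 1 + 2 * T (int g)) * real h = 2 * (h * (T 1 + T (int g)))"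
      by (simp add: algebra_simps)
    then show "(2 * T 1 + 2 * T (int g)) * real h = - 2 * real (card V)"
      unfolding hT by simp
  qed (use h card_V_pos in \<open>simp_all del: card_eq_0_iff card_0_eq\<close>)
  then have "2 * T 1 / card V + 2 * T (int g) / card V = of_int (- 2) / of_int (int h)"
    by (simp add: add_divide_distrib)
  then have "algebraic_int (complex_of_real (of_int (- 2) / of_int (int h)))"
    using algebraic_int_add_mult(1)[OF algebraic_int_spectrum[OF per, of "1 * c"] algebraic_int_spectrum[OF per, of "int g * c"]]
    by (simp only: T_def of_real_add[symmetric])
  then have "int h dvd - 2" by (rule algebraic_int_fraction) (use h in simp)
  then have "int h dvd int 2" by simp
  then have "h dvd 2" by (simp only: of_nat_dvd_iff)
  then have "h = 1 \<or> h = 2" using dvd_imp_le[of h 2] h(2) by auto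
  then show ?thesis using h(1) P(2) by auto
qed simp

end

section \<open>The periodic cases\<close>

text \<open>Supplies the unit for \<open>spectrum_vanishes\<close> with \<open>M = 24\<close>: u^2 -
  1 must miss divisibility by \<open>d\<close>, yet by no more than a divisor of 24. Here 16 or 9
  divides \<open>d\<close>, and \<open>u\<close> is built to miss one factor 2 or one factor
  3.\<close>

lemma exists_unit_two_three:
  fixes d :: int
  assumes d: "d = 2 ^ x * 3 ^ y" "\<not> d dvd 24"
  obtains u where "coprime u 2" "coprime u 3" "d dvd 24 * (u\<^sup>2 - 1)" "\<not> d dvd u\<^sup>2 - 1"
proof -
  have "\<not> (x \<le> 3 \<and> y \<le> 1)"
  proof
    assume "x \<le> 3 \<and> y \<le> 1"
    then have "d dvd 2 ^ 3 * 3 ^ 1"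
      unfolding d(1) by (intro mult_dvd_mono le_imp_power_dvd) auto
    then show False using d(2) by simp
  qed
  then have "4 \<le> x \<or> 2 \<le> y" by linarith
  then consider i where "x = 4 + i" | i where "y = 2 + i"
    using le_Suc_ex by metis
  then show ?thesis
  proof cases
    case 1
    \<comment> \<open>As \<open>w\<close> is odd, u^2 - 1 contains 2 exactly \<open>i + 3\<close>
      times, one less than \<open>d\<close>. The exponent \<open>y + 1\<close> makes
      \<open>u\<close> prime to 3 even for \<open>y = 0\<close>.\<close>
    define u where "u = 1 + 2 ^ (i + 2) * (3 :: int) ^ (y + 1)"
    define w where "w = 1 + 2 ^ (i + 1) * (3 :: int) ^ (y + 1)"
    have e: "u\<^sup>2 - 1 = 2 ^ (i + 3) * (3 ^ (y + 1) * w)"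
      by (simp add: u_def w_def power2_eq_square power_add algebra_simps)
    have "24 * (u\<^sup>2 - 1) = d * (2 ^ 2 * 3 ^ 2 * w)"
      unfolding e d(1) 1 by (simp add: power_add)
    then have "d dvd 24 * (u\<^sup>2 - 1)" by simp
    moreover have "\<not> d dvd u\<^sup>2 - 1"
    proof
      assume "d dvd u\<^sup>2 - 1"
      moreover have "2 ^ (i + 3) * 2 dvd d" by (simp add: d(1) 1 power_add)
      ultimately have "2 ^ (i + 3) * 2 dvd 2 ^ (i + 3) * (3 ^ (y + 1) * w)"
        unfolding e using dvd_trans by blast
      then have "2 dvd 3 ^ (y + 1) * w"
        by (subst (asm) dvd_mult_cancel_left) simp
      then show False by (simp add: w_def)
    qed
    moreover have "\<not> 3 dvd u" by (simp add: u_def dvd_add_left_iff)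
    then have "coprime u 3" using prime_imp_coprime[of 3 u] by (simp add: coprime_commute)
    moreover have "coprime u 2" by (simp add: u_def)
    ultimately show ?thesis using that by blast
  next
    case 2
    \<comment> \<open>Now u^2 - 1 contains 3 exactly \<open>i + 1\<close> times, one less than
      \<open>d\<close>.\<close>
    define u where "u = 1 + 2 ^ (x + 1) * (3 :: int) ^ (i + 1)"
    define w where "w = 1 + 2 ^ x * (3 :: int) ^ (i + 1)"
    have e: "u\<^sup>2 - 1 = 3 ^ (i + 1) * (2 ^ (x + 2) * w)"
      by (simp add: u_def w_def power2_eq_square power_add algebra_simps)
    have "24 * (u\<^sup>2 - 1) = d * (2 ^ 5 * w)"
      unfolding e d(1) 2 by (simp add: power_add)
    then have "d dvd 24 * (u\<^sup>2 - 1)" by simp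
    moreover have "\<not> d dvd u\<^sup>2 - 1"
    proof
      assume "d dvd u\<^sup>2 - 1"
      moreover have "3 ^ (i + 1) * 3 dvd d" by (simp add: d(1) 2 power_add)
      ultimately have "3 ^ (i + 1) * 3 dvd 3 ^ (i + 1) * (2 ^ (x + 2) * w)"
        unfolding e using dvd_trans by blast
      then have "3 dvd 2 ^ (x + 2) * w"
        by (subst (asm) dvd_mult_cancel_left) simp
      moreover have three: "prime (3 :: int)" by simp
      ultimately have "(3 :: int) dvd 2 \<or> 3 dvd w"
        using prime_dvd_multD[OF three] prime_dvd_power[OF three] by blast
      then show False by (simp add: w_def dvd_add_left_iff)
    qed
    moreover have "\<not> 3 dvd u" by (simp add: u_def dvd_add_left_iff)
    then have "coprime u 3" using prime_imp_coprime[of 3 u] by (simp add: coprime_commute)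
    moreover have "coprime u 2" by (simp add: u_def)
    ultimately show ?thesis using that by blast
  qed
qed

text \<open>The analogous unit for \<open>M = 5\<close>. Since x is at most 2, the failure of
  \<open>d dvd 20\<close> means that 25 divides \<open>d\<close>; u^2 - 1 misses one factor 5, while
  its factor 8 covers the power of 2.\<close>

lemma exists_unit_two_five:
  fixes d :: int
  assumes d: "d = 2 ^ x * 5 ^ y" "x \<le> 2" "\<not> d dvd 20"
  obtains u where "coprime u 2" "coprime u 5" "5 dvd u\<^sup>2 - 1" "d dvd 5 * (u\<^sup>2 - 1)" "\<not> d dvd u\<^sup>2 - 1"
proof -
  have "\<not> y \<le> 1"
  proof
    assume "y \<le> 1"
    then have "d dvd 2 ^ 2 * 5 ^ 1"
      unfolding d(1) using d(2) by (intro mult_dvd_mono le_imp_power_dvd) auto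
    then show False using d(3) by simp
  qed
  then have "2 \<le> y" by simp
  then obtain i where i: "y = 2 + i" using le_Suc_ex by blast
  define u where "u = 1 + 4 * (5 :: int) ^ (i + 1)"
  define w where "w = 1 + 2 * (5 :: int) ^ (i + 1)"
  have e: "u\<^sup>2 - 1 = 5 ^ (i + 1) * (8 * w)"
    by (simp add: u_def w_def power2_eq_square power_add algebra_simps)
  have "5 * (u\<^sup>2 - 1) = (2 ^ 3 * 5 ^ y) * w"
    unfolding e i by (simp add: power_add)
  moreover have "d dvd 2 ^ 3 * 5 ^ y"
    unfolding d(1) using d(2) by (intro mult_dvd_mono le_imp_power_dvd) auto
  ultimately have "d dvd 5 * (u\<^sup>2 - 1)" by (simp only: dvd_mult2)
  moreover have "\<not> d dvd u\<^sup>2 - 1"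
  proof
    assume "d dvd u\<^sup>2 - 1"
    moreover have "5 ^ (i + 1) * 5 dvd d" by (simp add: d(1) i power_add)
    ultimately have "5 ^ (i + 1) * 5 dvd 5 ^ (i + 1) * (8 * w)"
      unfolding e using dvd_trans by blast
    then have "5 dvd 8 * w"
      by (subst (asm) dvd_mult_cancel_left) simp
    moreover have five: "prime (5 :: int)" by simp
    ultimately have "(5 :: int) dvd 8 \<or> 5 dvd w"
      using prime_dvd_multD[OF five] by blast
    then show False by (simp add: w_def dvd_add_left_iff)
  qed
  moreover have "5 dvd u\<^sup>2 - 1" unfolding e by simp
  moreover have "\<not> 5 dvd u" by (simp add: u_def dvd_add_left_iff)
  then have "coprime u 5" using prime_imp_coprime[of 5 u] by (simp add: coprime_commute)
  moreover have "coprime u 2" by (simp add: u_def)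
  ultimately show ?thesis using that by blast
qed

lemma two_three_five_factorization:
  fixes n :: int
  assumes "n > 0" "\<And>p. prime p \<Longrightarrow> p dvd n \<Longrightarrow> p \<in> {2, 3, 5}"
  shows "\<exists>a b c. n = 2 ^ a * 3 ^ b * 5 ^ c"
  using assms
proof (induction "nat n" arbitrary: n rule: less_induct)
  case less
  show ?case
  proof (cases "n = 1")
    case True
    then have "n = 2 ^ 0 * 3 ^ 0 * 5 ^ 0" by simp
    then show ?thesis by blast
  next
    case False
    then obtain p where p: "prime p" "p dvd n"
      using prime_divisor_exists[of n] less.prems(1) by auto
    then obtain m where m: "n = p * m" by blast
    have "m > 0" using less.prems(1) p(1) m by (metis prime_gt_0_int zero_less_mult_pos)
    moreover have "m < n" using \<open>m > 0\<close> m prime_ge_2_int[OF p(1)] by simp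
    ultimately obtain a b c where abc: "m = 2 ^ a * 3 ^ b * 5 ^ c"
      using less.hyps[of m] less.prems m by auto
    consider "p = 2" | "p = 3" | "p = 5" using less.prems(2)[OF p] by auto
    then show ?thesis
    proof cases
      case 1
      then have "n = 2 ^ Suc a * 3 ^ b * 5 ^ c" using m abc by simp
      then show ?thesis by blast
    next
      case 2
      then have "n = 2 ^ a * 3 ^ Suc b * 5 ^ c" using m abc by simp
      then show ?thesis by blast
    next
      case 3
      then have "n = 2 ^ a * 3 ^ b * 5 ^ Suc c" using m abc by simp
      then show ?thesis by blast
    qed
  qed
qed

section \<open>Eigenvalues as cosines of rational angles in the two families\<close>

context quadratic_Cayley
begin

text \<open>Writes the eigenvalue 0 as the cosine of a quarter turn; for this the common denominator
  \<open>4 * n\<close> is used instead of \<open>n\<close>.\<close>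

lemma frac_cos_quarter: "frac_cos (4 * n) n = 0"
proof -
  have "2 * pi * of_int n / of_int (4 * n) = pi / 2" using n_pos by simp
  then show ?thesis by (simp only: frac_cos_def cos_pi_half)
qed

lemma reduced_fraction:
  obtains g m b where "n = g * m" "a = g * b" "coprime m b" "m > 0" "g \<noteq> 0"
proof -
  define g where "g = gcd n a"
  have g: "g > 0" "g \<noteq> 0" using n_pos by (simp_all add: g_def)
  obtain m b where "n = m * g" "a = b * g" and "coprime m b"
    using gcd_coprime_exists[OF g(2)[unfolded g_def]] unfolding g_def by blast
  then have mb: "n = g * m" "a = g * b" "coprime m b" by (simp_all only: mult.commute)
  have "m > 0" using mb(1) g n_pos by (metis zero_less_mult_pos)
  then show ?thesis using mb g that by auto
qed

lemma periodicI_quarter: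
  assumes "\<And>a. \<exists>t. quadratic_spectrum n a = card V * frac_cos (4 * n) t"
  shows "grover_periodic \<G>"
  by (rule periodic_of_spectrum[of "nat (4 * n)"]) (use assms n_pos in \<open>auto simp: even_nat_iff\<close>)

text \<open>If \<open>n\<close> divides \<open>24 * a\<close>, all terms of the eigenvalue agree
  because unit squares are 1 modulo 24, and the eigenvalue is the degree times one cosine. Otherwise
  the reduced denominator of \<open>a / n\<close> does not divide 24, and the eigenvalue
  vanishes.\<close>

lemma periodic_two_three:
  assumes n: "n = 2 ^ \<alpha> * 3 ^ \<beta>"
  shows "grover_periodic \<G>"
proof (rule periodicI_quarter)
  fix a
  show "\<exists>t. quadratic_spectrum n a = card V * frac_cos (4 * n) t"
  proof (cases "n dvd 24 * a")
    case True
    have "quadratic_spectrum n a = card V * frac_cos n a"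
    proof (rule spectrum_constant)
      fix s assume s: "s \<in> V"
      obtain r e where r: "coprime r n" "coprime r 24" "e = 1 \<or> e = -1" "n dvd s - e * r\<^sup>2"
        by (rule connection_set_lift[OF s, of 24]) auto
      have "24 dvd r\<^sup>2 - 1" using squares_mod_24[OF r(2)] by (simp add: mod_eq_dvd_iff[symmetric])
      then obtain q where "r\<^sup>2 - 1 = 24 * q" by blast
      then have "a * r\<^sup>2 - a = 24 * a * q" by (simp add: algebra_simps)
      then have "frac_cos n (a * r\<^sup>2) = frac_cos n a"
        using True by (intro frac_cos_dvd n_pos) (simp only: dvd_mult2)
      moreover have "frac_cos n (a * s) = frac_cos n (a * (e * r\<^sup>2))"
        using r(4) by (intro frac_cos_dvd n_pos) (simp flip: right_diff_distrib)
      ultimately show "frac_cos n (a * s) = frac_cos n a" using r(3) by auto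
    qed
    then have "quadratic_spectrum n a = card V * frac_cos (4 * n) (a * 4)"
      using frac_cos_cancel[of 4 n a] by (simp add: mult.commute)
    then show ?thesis by blast
  next
    case False
    obtain g m b where m: "n = g * m" "a = g * b" "coprime m b" "m > 0" "g \<noteq> 0"
      by (rule reduced_fraction)
    have "\<not> m dvd 24" using False m(1,2) by (auto simp: mult.left_commute mult_dvd_mono)
    moreover obtain x y where "x \<le> \<alpha>" "y \<le> \<beta>" "m = 2 ^ x * 3 ^ y"
      by (rule dvd_two_prime_powers[of 2 3 m \<alpha> \<beta>]) (use m(1,4) n in simp_all)
    ultimately obtain u where u: "coprime u 2" "coprime u 3" "m dvd 24 * (u\<^sup>2 - 1)" "\<not> m dvd u\<^sup>2 - 1"
      using exists_unit_two_three by blast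
    have "quadratic_spectrum n a = 0"
    proof (rule spectrum_vanishes[of u 24])
      show "coprime u n" unfolding n using u(1,2) by simp
      have "coprime u (2 * (2 * (2 * 3)))" using u(1,2) by (simp only: coprime_mult_right_iff)
      then have "coprime u 24" by simp
      then show "24 dvd u\<^sup>2 - 1" using squares_mod_24 by (simp add: mod_eq_dvd_iff[symmetric])
      have "g * m dvd g * (24 * (u\<^sup>2 - 1) * b)" using u(3) by (intro mult_dvd_mono) simp_all
      then show "n dvd 24 * (a * (u\<^sup>2 - 1))" by (simp add: m(1,2) mult_ac)
      show "\<not> n dvd a * (u\<^sup>2 - 1)"
      proof
        assume "n dvd a * (u\<^sup>2 - 1)"
        then have "m dvd b * (u\<^sup>2 - 1)" using m(5) by (simp add: m(1,2) mult.assoc)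
        then show False using u(4) coprime_dvd_mult_right_iff[OF m(3)] by blast
      qed
      fix s assume s: "s \<in> V"
      obtain r e where r: "coprime r n" "coprime r 24" "e = 1 \<or> e = -1" "n dvd s - e * r\<^sup>2"
        by (rule connection_set_lift[OF s, of 24]) auto
      have "24 dvd r\<^sup>2 - 1" using squares_mod_24[OF r(2)] by (simp add: mod_eq_dvd_iff[symmetric])
      then have "24 dvd e * r\<^sup>2 - 1 \<or> 24 dvd e * r\<^sup>2 + 1" using r(3) dvd_minus_iff[of 24 "r\<^sup>2 - 1"] by auto
      then show "\<exists>w. n dvd s - w \<and> (24 dvd w - 1 \<or> 24 dvd w + 1)" using r(4) by blast
    qed
    then show ?thesis using frac_cos_quarter by (intro exI[of _ n]) simp
  qed
qed

text \<open>As 3 is a unit, the terms at \<open>a * s\<close> and \<open>9 * a * s\<close> may be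
  averaged; their sum is a product of cosines at \<open>5 * a * s\<close> and
  \<open>4 * a * s\<close>. These depend on \<open>s\<close> only modulo 4 and modulo 5, where
  \<open>s\<close> is 1 or -1.\<close>

lemma spectrum_of_dvd_20:
  assumes n: "n dvd 20 * a" and three: "coprime 3 n"
  shows "quadratic_spectrum n a = card V * (frac_cos n (5 * a) * frac_cos n (4 * a))"
proof -
  have "frac_cos n (a * 3\<^sup>2 * s) + frac_cos n (a * s) = 2 * (frac_cos n (5 * a) * frac_cos n (4 * a))"
    if s: "s \<in> V" for s
  proof -
    obtain r e where r: "coprime r n" "coprime r 20" "e = 1 \<or> e = -1" "n dvd s - e * r\<^sup>2"
      by (rule connection_set_lift[OF s, of 20]) auto
    have "frac_cos n (y * s) = frac_cos n (y * (e * r\<^sup>2))" for y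
      using r(4) by (intro frac_cos_dvd n_pos) (simp flip: right_diff_distrib)
    then have A: "frac_cos n (y * s) = frac_cos n (y * r\<^sup>2)" for y
      using r(3) by auto
    have "frac_cos n (a * 3\<^sup>2 * s) + frac_cos n (a * s) = 2 * frac_cos n (5 * a * s) * frac_cos n (4 * a * s)"
      using frac_cos_add_diff[of n "5 * a * s" "4 * a * s"] by (simp add: mult_ac)
    also have "frac_cos n (5 * a * s) = frac_cos n (5 * a)"
    proof -
      have "4 dvd r\<^sup>2 - 1" using squares_mod_20[OF r(2)] by auto presburger+
      then obtain q where "r\<^sup>2 - 1 = 4 * q" by blast
      then have "5 * a * r\<^sup>2 - 5 * a = 20 * a * q" by (simp add: algebra_simps)
      then show ?thesis
        unfolding A using n by (intro frac_cos_dvd n_pos) (simp only: dvd_mult2)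
    qed
    also have "frac_cos n (4 * a * s) = frac_cos n (4 * a)"
    proof -
      have "5 dvd r\<^sup>2 - 1 \<or> 5 dvd r\<^sup>2 + 1" using squares_mod_20[OF r(2)] by auto presburger+
      then show ?thesis
      proof
        assume "5 dvd r\<^sup>2 - 1"
        then obtain q where "r\<^sup>2 - 1 = 5 * q" by blast
        then have "4 * a * r\<^sup>2 - 4 * a = 20 * a * q" by (simp add: algebra_simps)
        then show ?thesis
          unfolding A using n by (intro frac_cos_dvd n_pos) (simp only: dvd_mult2)
      next
        assume "5 dvd r\<^sup>2 + 1"
        then obtain q where q: "r\<^sup>2 + 1 = 5 * q" by blast
        have "4 * a * r\<^sup>2 - - (4 * a) = 4 * a * (r\<^sup>2 + 1)" by (simp add: algebra_simps)
        then have "4 * a * r\<^sup>2 - - (4 * a) = 20 * a * q" unfolding q by simp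
        then have "frac_cos n (4 * a * r\<^sup>2) = frac_cos n (- (4 * a))"
          using n by (intro frac_cos_dvd n_pos) (simp only: dvd_mult2)
        then show ?thesis by (simp add: A)
      qed
    qed
    finally show ?thesis by simp
  qed
  then have "(\<Sum>s\<in>V. frac_cos n (a * 3\<^sup>2 * s) + frac_cos n (a * s)) =
      card V * (2 * (frac_cos n (5 * a) * frac_cos n (4 * a)))"
    by simp
  then have "quadratic_spectrum n (a * 3\<^sup>2) + quadratic_spectrum n a =
      card V * (2 * (frac_cos n (5 * a) * frac_cos n (4 * a)))"
    by (simp only: quadratic_spectrum_def sum.distrib)
  then show ?thesis using spectrum_square[OF three, of a] by simp
qed

lemma periodic_two_five:
  assumes n: "n = 2 ^ \<delta> * 5 ^ \<gamma>" and "\<delta> \<le> 2" "\<gamma> \<ge> 1"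
  shows "grover_periodic \<G>"
proof (rule periodicI_quarter)
  fix a
  show "\<exists>t. quadratic_spectrum n a = card V * frac_cos (4 * n) t"
  proof (cases "n dvd 20 * a")
    case True
    then obtain q where q: "20 * a = n * q" by blast
    have "coprime 3 (2 :: int)" "coprime 3 (5 :: int)"
      by (simp_all add: coprime_iff_gcd_eq_1 gcd_non_0_int)
    then have spec: "quadratic_spectrum n a = card V * (frac_cos n (5 * a) * frac_cos n (4 * a))"
      using True n by (intro spectrum_of_dvd_20) simp_all
    \<comment> \<open>\<open>5 * a / n\<close> equals \<open>q / 4\<close>, so the first factor is
      the cosine of \<open>q\<close> quarter turns.\<close>
    have fifth: "frac_cos n (5 * a) = frac_cos (4 * n) (n * q)" "frac_cos n (4 * a) = frac_cos (4 * n) (16 * a)"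
      using frac_cos_cancel[of 4 n "5 * a"] frac_cos_cancel[of 4 n "4 * a"] q by (simp_all add: mult_ac)
    have angle: "2 * pi * of_int (n * q) / of_int (4 * n) = of_int q * (pi / 2)"
      using n_pos by simp
    show ?thesis
    \<comment> \<open>For even \<open>q\<close> the sine of \<open>q\<close> quarter turns vanishes
      and the addition formula merges the two cosines into one; for odd \<open>q\<close> the product
      is 0.\<close>
    proof (cases "even q")
      case True
      then obtain k where k: "q = 2 * k" by blast
      have "sin (2 * pi * of_int (n * q) / of_int (4 * n)) = 0"
        unfolding angle k by simp
      then have "frac_cos (4 * n) (16 * a + n * q) = frac_cos n (4 * a) * frac_cos n (5 * a)"
        unfolding fifth by (simp only: frac_cos_def of_int_add distrib_left add_divide_distrib cos_add)
      then show ?thesis using spec by (metis mult.commute)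
    next
      case False
      then obtain k where k: "q = 2 * k + 1" by (rule oddE)
      have "frac_cos (4 * n) (n * q) = cos (of_int k * pi + pi / 2)"
      proof -
        have "of_int q * (pi / 2) = of_int k * pi + pi / 2" unfolding k by (simp add: field_simps)
        then show ?thesis by (simp only: frac_cos_def angle)
      qed
      also have "\<dots> = 0" by (simp add: cos_add mult.commute[of "of_int k" pi])
      finally show ?thesis
        using spec fifth frac_cos_quarter by (intro exI[of _ n]) simp
    qed
  next
    case False
    obtain g m b where m: "n = g * m" "a = g * b" "coprime m b" "m > 0" "g \<noteq> 0"
      by (rule reduced_fraction)
    have "\<not> m dvd 20" using False m(1,2) by (auto simp: mult.left_commute mult_dvd_mono)
    moreover obtain x y where "x \<le> \<delta>" "y \<le> \<gamma>" "m = 2 ^ x * 5 ^ y"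
      by (rule dvd_two_prime_powers[of 2 5 m \<delta> \<gamma>]) (use m(1,4) n in simp_all)
    moreover have "x \<le> 2" using \<open>x \<le> \<delta>\<close> assms(2) by simp
    ultimately obtain u where u: "coprime u 2" "coprime u 5" "5 dvd u\<^sup>2 - 1" "m dvd 5 * (u\<^sup>2 - 1)" "\<not> m dvd u\<^sup>2 - 1"
      using exists_unit_two_five by blast
    have "quadratic_spectrum n a = 0"
    proof (rule spectrum_vanishes[of u 5])
      show "coprime u n" unfolding n using u(1,2) by simp
      show "5 dvd u\<^sup>2 - 1" by (rule u(3))
      have "g * m dvd g * (5 * (u\<^sup>2 - 1) * b)" using u(4) by (intro mult_dvd_mono) simp_all
      then show "n dvd 5 * (a * (u\<^sup>2 - 1))" by (simp add: m(1,2) mult_ac)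
      show "\<not> n dvd a * (u\<^sup>2 - 1)"
      proof
        assume "n dvd a * (u\<^sup>2 - 1)"
        then have "m dvd b * (u\<^sup>2 - 1)" using m(5) by (simp add: m(1,2) mult.assoc)
        then show False using u(5) coprime_dvd_mult_right_iff[OF m(3)] by blast
      qed
      fix s assume s: "s \<in> V"
      obtain r e where r: "coprime r n" "coprime r 20" "e = 1 \<or> e = -1" "n dvd s - e * r\<^sup>2"
        by (rule connection_set_lift[OF s, of 20]) auto
      have "5 dvd r\<^sup>2 - 1 \<or> 5 dvd r\<^sup>2 + 1" using squares_mod_20[OF r(2)] by auto presburger+
      then have "5 dvd e * r\<^sup>2 - 1 \<or> 5 dvd e * r\<^sup>2 + 1"
        using r(3) dvd_minus_iff[of 5 "r\<^sup>2 - 1"] dvd_minus_iff[of 5 "r\<^sup>2 + 1"] by auto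
      then show "\<exists>w. n dvd s - w \<and> (5 dvd w - 1 \<or> 5 dvd w + 1)" using r(4) by blast
    qed
    then show ?thesis using frac_cos_quarter by (intro exI[of _ n]) simp
  qed
qed

end

section \<open>Combination of the excluded divisors with the two periodic families\<close>

theorem theorem4p11:
  fixes n :: int
  assumes "n \<ge> 2"
  shows "grover_periodic (quadratic_unitary_Cayley_graph n) \<longleftrightarrow>
    (\<exists>\<alpha> \<beta> :: nat. \<alpha> + \<beta> \<noteq> 0 \<and> n = 2 ^ \<alpha> * 3 ^ \<beta>) \<or>
    (\<exists>\<delta> \<gamma> :: nat. \<gamma> \<ge> 1 \<and> \<delta> \<le> 2 \<and> n = 2 ^ \<delta> * 5 ^ \<gamma>)"
proof -
  interpret quadratic_Cayley n by (unfold_locales) (rule assms)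
  show ?thesis
  proof
    assume per: "grover_periodic \<G>"
    obtain a b c where n: "n = 2 ^ a * 3 ^ b * 5 ^ c"
      using two_three_five_factorization[OF n_pos(1) periodic_prime_dvd[OF per]] by blast
    show "(\<exists>\<alpha> \<beta> :: nat. \<alpha> + \<beta> \<noteq> 0 \<and> n = 2 ^ \<alpha> * 3 ^ \<beta>) \<or>
      (\<exists>\<delta> \<gamma> :: nat. \<gamma> \<ge> 1 \<and> \<delta> \<le> 2 \<and> n = 2 ^ \<delta> * 5 ^ \<gamma>)"
    proof (cases "c = 0")
      case True
      then have "n = 2 ^ a * 3 ^ b" using n by simp
      moreover have "a + b \<noteq> 0" using calculation assms by (cases "a + b = 0") auto
      ultimately show ?thesis by blast
    next
      case False
      have "b = 0"
      proof (rule ccontr)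
        assume "b \<noteq> 0"
        then have "3 ^ 1 * 5 ^ 1 dvd (3 ^ b * 5 ^ c :: int)"
          using False by (intro mult_dvd_mono le_imp_power_dvd) auto
        then have "15 dvd n" unfolding n by (simp add: mult.assoc dvd_mult)
        then show False using periodic_not_15_dvd[OF per] by simp
      qed
      moreover have "a \<le> 2"
      proof (rule ccontr)
        assume "\<not> a \<le> 2"
        then have "2 ^ 3 * 5 ^ 1 dvd (2 ^ a * 5 ^ c :: int)"
          using False by (intro mult_dvd_mono le_imp_power_dvd) auto
        then have "40 dvd n" unfolding n by (simp add: \<open>b = 0\<close>)
        then show False using periodic_not_40_dvd[OF per] by simp
      qed
      ultimately show ?thesis using n False by (intro disjI2 exI[of _ a] exI[of _ c]) simp
    qed
  qed (use periodic_two_three periodic_two_five in blast)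
qed

end
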